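(* (a) $\mathbf{IA_1}+\mathrm{QF\text{-}AC_{00}}$ does not prove $\mathrm{CF_d}$ (i.e. some instance of $\mathrm{CF_d}$ is unprovable). (b) $\mathbf{EL}$ does not prove $\mathrm{CF_d}$.
   Context: All systems are based on two-sorted intuitionistic predicate logic with number variables (natural numbers) and function variables (one-place number-theoretic functions); number equality is primitive, $u=v:\equiv\forall x\,u(x)=v(x)$. $\mathbf{IA_1}$: language with $0,',+,\cdot$ and finitely many further primitive recursive function(al) constants (exponentiation, factorial, predecessor, cut-off subtraction, min, max, $\mathrm{sg}$, $\overline{\mathrm{sg}}$, $|a-b|$, remainder, quotient, bounded sums/products/min/max of function values, prime enumeration, exponent $(a)_i$, length, concatenation, $\overline{\alpha}(x)$, $\widetilde{\alpha}(x)$, $a\circ b$, Kleene's $\mathrm{ccp}$), application and $\lambda$-abstraction; axioms: Peano axioms for $0,',+,\cdot$, equality axioms, defining equations, $x=y\to\alpha(x)=\alpha(y)$, $\lambda$-conversion, induction for all formulas. $\mathbf{EL}=\mathbf{HA_1}+\mathrm{QF\text{-}AC_{00}}$, where $\mathbf{HA_1}$ has $0$, a constant for each primitive recursive description, application, $\lambda$, and recursor $\mathrm{rec}$ with axioms $x=x$, $A(x)\,\&\,x=y\to A(y)$, induction, $\neg S(0)=0$, defining equations, $\lambda$-conversion, $\mathrm{rec}(t,u,0)=t$, $\mathrm{rec}(t,u,S(s))=u(\langle\mathrm{rec}(t,u,s),s\rangle)$ with $\langle a,b\rangle=2^a3^b$. $\mathrm{QF\text{-}AC_{00}}$: $\forall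 x\exists y\,A(x,y)\to\exists\alpha\forall x\,A(x,\alpha(x))$ for quantifier-free $A$ not containing $\alpha$. $\mathrm{CF_d}$: $\forall x(B(x)\vee\neg B(x))\to\exists\beta\forall x[\beta(x)\le 1\,\&\,(\beta(x)=0\leftrightarrow B(x))]$ ($\beta$ not free in $B$). *)

theory Defs
  imports Main
begin

section \<open>Two-sorted syntax\<close>

text \<open>
  A language is given by a type of constants, each of arity \<open>(k, l)\<close>: it takes \<open>k\<close> number arguments
  and \<open>l\<close> function arguments and yields a number; \<open>None\<close> marks elements of the type that are not
  constants of the language.
\<close>

class lang =
  fixes arity :: "'a \<Rightarrow> (nat \<times> nat) option"
    and cZero :: 'a
    and cSuc :: 'a
    and cPlus :: 'a

text \<open>
  Terms (of number sort) and functors (of function sort), with de Bruijn indices. Number variables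
  \<open>NV\<close> and function variables \<open>FV\<close> are indexed independently: \<open>Lam\<close>, \<open>AllN\<close>, \<open>ExN\<close> bind the number
  index 0 and leave function indices alone; \<open>AllF\<close>, \<open>ExF\<close> bind the function index 0 and leave number
  indices alone.
\<close>

datatype 'c trm =
    NV nat
  | Con 'c "'c trm list" "'c fctr list"
  | Ap "'c fctr" "'c trm"
and 'c fctr =
    FV nat
  | FC 'c
  | Lam "'c trm"

datatype 'c fm =
    Eq "'c trm" "'c trm" (infix \<open>\<^bold>=\<close> 55)
  | Neg "'c fm" (\<open>\<^bold>\<not> _\<close> [53] 53)
  | Conj "'c fm" "'c fm" (infixr \<open>\<^bold>\<and>\<close> 50)
  | Disj "'c fm" "'c fm" (infixr \<open>\<^bold>\<or>\<close> 48)
  | Imp "'c fm" "'c fm" (infixr \<open>\<^bold>\<longrightarrow>\<close> 45)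
  | AllN "'c fm"
  | ExN "'c fm"
  | AllF "'c fm"
  | ExF "'c fm"

text \<open>
  A constant of arity \<open>(1, 0)\<close> is itself a functor \<open>FC c\<close>, and \<open>c(t)\<close> is \<open>Ap (FC c) t\<close>. To have only
  one representation of \<open>c(t)\<close>, \<open>Con c [t] []\<close> is not counted as well-formed.
\<close>

primrec wf_trm :: "'c::lang trm \<Rightarrow> bool" and wf_fctr :: "'c fctr \<Rightarrow> bool" where
  "wf_trm (NV i) = True"
| "wf_trm (Con c ts us) =
     (arity c = Some (length ts, length us) \<and> arity c \<noteq> Some (1, 0) \<and>
      list_all (\<lambda>b. b) (map wf_trm ts) \<and> list_all (\<lambda>b. b) (map wf_fctr us))"
| "wf_trm (Ap u t) = (wf_fctr u \<and> wf_trm t)"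
| "wf_fctr (FV i) = True"
| "wf_fctr (FC c) = (arity c = Some (1, 0))"
| "wf_fctr (Lam t) = wf_trm t"

primrec wf_fm :: "'c::lang fm \<Rightarrow> bool" where
  "wf_fm (s \<^bold>= t) = (wf_trm s \<and> wf_trm t)"
| "wf_fm (\<^bold>\<not> A) = wf_fm A"
| "wf_fm (A \<^bold>\<and> B) = (wf_fm A \<and> wf_fm B)"
| "wf_fm (A \<^bold>\<or> B) = (wf_fm A \<and> wf_fm B)"
| "wf_fm (A \<^bold>\<longrightarrow> B) = (wf_fm A \<and> wf_fm B)"
| "wf_fm (AllN A) = wf_fm A"
| "wf_fm (ExN A) = wf_fm A"
| "wf_fm (AllF A) = wf_fm A"
| "wf_fm (ExF A) = wf_fm A"

primrec quantifier_free :: "'c fm \<Rightarrow> bool" where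
  "quantifier_free (s \<^bold>= t) = True"
| "quantifier_free (\<^bold>\<not> A) = quantifier_free A"
| "quantifier_free (A \<^bold>\<and> B) = (quantifier_free A \<and> quantifier_free B)"
| "quantifier_free (A \<^bold>\<or> B) = (quantifier_free A \<and> quantifier_free B)"
| "quantifier_free (A \<^bold>\<longrightarrow> B) = (quantifier_free A \<and> quantifier_free B)"
| "quantifier_free (AllN A) = False"
| "quantifier_free (ExN A) = False"
| "quantifier_free (AllF A) = False"
| "quantifier_free (ExF A) = False"

text \<open>Simultaneous renaming by \<open>\<rho>\<close> (number indices) and \<open>\<xi>\<close> (function indices).\<close>

abbreviation lift_ren :: "(nat \<Rightarrow> nat) \<Rightarrow> nat \<Rightarrow> nat" where
  "lift_ren \<rho> \<equiv> case_nat 0 (\<lambda>i. Suc (\<rho> i))"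

primrec ren_trm :: "(nat \<Rightarrow> nat) \<Rightarrow> (nat \<Rightarrow> nat) \<Rightarrow> 'c trm \<Rightarrow> 'c trm"
  and ren_fctr :: "(nat \<Rightarrow> nat) \<Rightarrow> (nat \<Rightarrow> nat) \<Rightarrow> 'c fctr \<Rightarrow> 'c fctr" where
  "ren_trm \<rho> \<xi> (NV i) = NV (\<rho> i)"
| "ren_trm \<rho> \<xi> (Con c ts us) = Con c (map (ren_trm \<rho> \<xi>) ts) (map (ren_fctr \<rho> \<xi>) us)"
| "ren_trm \<rho> \<xi> (Ap u t) = Ap (ren_fctr \<rho> \<xi> u) (ren_trm \<rho> \<xi> t)"
| "ren_fctr \<rho> \<xi> (FV i) = FV (\<xi> i)"
| "ren_fctr \<rho> \<xi> (FC c) = FC c"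
| "ren_fctr \<rho> \<xi> (Lam t) = Lam (ren_trm (lift_ren \<rho>) \<xi> t)"

primrec ren_fm :: "(nat \<Rightarrow> nat) \<Rightarrow> (nat \<Rightarrow> nat) \<Rightarrow> 'c fm \<Rightarrow> 'c fm" where
  "ren_fm \<rho> \<xi> (s \<^bold>= t) = (ren_trm \<rho> \<xi> s \<^bold>= ren_trm \<rho> \<xi> t)"
| "ren_fm \<rho> \<xi> (\<^bold>\<not> A) = (\<^bold>\<not> ren_fm \<rho> \<xi> A)"
| "ren_fm \<rho> \<xi> (A \<^bold>\<and> B) = (ren_fm \<rho> \<xi> A \<^bold>\<and> ren_fm \<rho> \<xi> B)"
| "ren_fm \<rho> \<xi> (A \<^bold>\<or> B) = (ren_fm \<rho> \<xi> A \<^bold>\<or> ren_fm \<rho> \<xi> B)"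
| "ren_fm \<rho> \<xi> (A \<^bold>\<longrightarrow> B) = (ren_fm \<rho> \<xi> A \<^bold>\<longrightarrow> ren_fm \<rho> \<xi> B)"
| "ren_fm \<rho> \<xi> (AllN A) = AllN (ren_fm (lift_ren \<rho>) \<xi> A)"
| "ren_fm \<rho> \<xi> (ExN A) = ExN (ren_fm (lift_ren \<rho>) \<xi> A)"
| "ren_fm \<rho> \<xi> (AllF A) = AllF (ren_fm \<rho> (lift_ren \<xi>) A)"
| "ren_fm \<rho> \<xi> (ExF A) = ExF (ren_fm \<rho> (lift_ren \<xi>) A)"

abbreviation "shiftN_trm \<equiv> ren_trm Suc id"
abbreviation "shiftN_fctr \<equiv> ren_fctr Suc id"
abbreviation "shiftN_fm \<equiv> ren_fm Suc id"
abbreviation "shiftF_trm \<equiv> ren_trm id Suc"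
abbreviation "shiftF_fctr \<equiv> ren_fctr id Suc"
abbreviation "shiftF_fm \<equiv> ren_fm id Suc"

text \<open>
  Simultaneous capture-avoiding substitution of terms \<open>\<sigma>\<close> for number variables and functors \<open>\<tau>\<close> for
  function variables.
\<close>

primrec subst_trm :: "(nat \<Rightarrow> 'c trm) \<Rightarrow> (nat \<Rightarrow> 'c fctr) \<Rightarrow> 'c trm \<Rightarrow> 'c trm"
  and subst_fctr :: "(nat \<Rightarrow> 'c trm) \<Rightarrow> (nat \<Rightarrow> 'c fctr) \<Rightarrow> 'c fctr \<Rightarrow> 'c fctr" where
  "subst_trm \<sigma> \<tau> (NV i) = \<sigma> i"
| "subst_trm \<sigma> \<tau> (Con c ts us) = Con c (map (subst_trm \<sigma> \<tau>) ts) (map (subst_fctr \<sigma> \<tau>) us)"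
| "subst_trm \<sigma> \<tau> (Ap u t) = Ap (subst_fctr \<sigma> \<tau> u) (subst_trm \<sigma> \<tau> t)"
| "subst_fctr \<sigma> \<tau> (FV i) = \<tau> i"
| "subst_fctr \<sigma> \<tau> (FC c) = FC c"
| "subst_fctr \<sigma> \<tau> (Lam t) =
     Lam (subst_trm (case_nat (NV 0) (\<lambda>i. shiftN_trm (\<sigma> i))) (\<lambda>i. shiftN_fctr (\<tau> i)) t)"

primrec subst_fm :: "(nat \<Rightarrow> 'c trm) \<Rightarrow> (nat \<Rightarrow> 'c fctr) \<Rightarrow> 'c fm \<Rightarrow> 'c fm" where
  "subst_fm \<sigma> \<tau> (s \<^bold>= t) = (subst_trm \<sigma> \<tau> s \<^bold>= subst_trm \<sigma> \<tau> t)"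
| "subst_fm \<sigma> \<tau> (\<^bold>\<not> A) = (\<^bold>\<not> subst_fm \<sigma> \<tau> A)"
| "subst_fm \<sigma> \<tau> (A \<^bold>\<and> B) = (subst_fm \<sigma> \<tau> A \<^bold>\<and> subst_fm \<sigma> \<tau> B)"
| "subst_fm \<sigma> \<tau> (A \<^bold>\<or> B) = (subst_fm \<sigma> \<tau> A \<^bold>\<or> subst_fm \<sigma> \<tau> B)"
| "subst_fm \<sigma> \<tau> (A \<^bold>\<longrightarrow> B) = (subst_fm \<sigma> \<tau> A \<^bold>\<longrightarrow> subst_fm \<sigma> \<tau> B)"
| "subst_fm \<sigma> \<tau> (AllN A) =
     AllN (subst_fm (case_nat (NV 0) (\<lambda>i. shiftN_trm (\<sigma> i))) (\<lambda>i. shiftN_fctr (\<tau> i)) A)"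
| "subst_fm \<sigma> \<tau> (ExN A) =
     ExN (subst_fm (case_nat (NV 0) (\<lambda>i. shiftN_trm (\<sigma> i))) (\<lambda>i. shiftN_fctr (\<tau> i)) A)"
| "subst_fm \<sigma> \<tau> (AllF A) =
     AllF (subst_fm (\<lambda>i. shiftF_trm (\<sigma> i)) (case_nat (FV 0) (\<lambda>i. shiftF_fctr (\<tau> i))) A)"
| "subst_fm \<sigma> \<tau> (ExF A) =
     ExF (subst_fm (\<lambda>i. shiftF_trm (\<sigma> i)) (case_nat (FV 0) (\<lambda>i. shiftF_fctr (\<tau> i))) A)"

text \<open>Instantiation of index 0 of the respective sort, the other indices moving down by one.\<close>

definition instN_trm :: "'c trm \<Rightarrow> 'c trm \<Rightarrow> 'c trm" where
  "instN_trm s t = subst_trm (case_nat t NV) FV s"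

definition instN :: "'c fm \<Rightarrow> 'c trm \<Rightarrow> 'c fm" where
  "instN A t = subst_fm (case_nat t NV) FV A"

definition instF :: "'c fm \<Rightarrow> 'c fctr \<Rightarrow> 'c fm" where
  "instF A u = subst_fm NV (case_nat u FV) A"

section \<open>Intuitionistic predicate logic\<close>

text \<open>
  Kleene's Hilbert-style calculus with nonlogical axioms from \<open>T\<close>. The variable conditions of the
  quantifier rules become shifts. Every formula occurring in a derivation is well-formed as soon as
  the members of \<open>T\<close> are.
\<close>

inductive proves :: "'c::lang fm set \<Rightarrow> 'c fm \<Rightarrow> bool" (infix \<open>\<turnstile>\<close> 40) for T where
  axiom: "A \<in> T \<Longrightarrow> T \<turnstile> A"
| MP: "T \<turnstile> A \<Longrightarrow> T \<turnstile> A \<^bold>\<longrightarrow> B \<Longrightarrow> T \<turnstile> B"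
| imp_K: "wf_fm A \<Longrightarrow> wf_fm B \<Longrightarrow> T \<turnstile> A \<^bold>\<longrightarrow> B \<^bold>\<longrightarrow> A"
| imp_S: "wf_fm A \<Longrightarrow> wf_fm B \<Longrightarrow> wf_fm C \<Longrightarrow>
    T \<turnstile> (A \<^bold>\<longrightarrow> B) \<^bold>\<longrightarrow> (A \<^bold>\<longrightarrow> B \<^bold>\<longrightarrow> C) \<^bold>\<longrightarrow> A \<^bold>\<longrightarrow> C"
| conj_I: "wf_fm A \<Longrightarrow> wf_fm B \<Longrightarrow> T \<turnstile> A \<^bold>\<longrightarrow> B \<^bold>\<longrightarrow> A \<^bold>\<and> B"
| conj_E1: "wf_fm A \<Longrightarrow> wf_fm B \<Longrightarrow> T \<turnstile> A \<^bold>\<and> B \<^bold>\<longrightarrow> A"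
| conj_E2: "wf_fm A \<Longrightarrow> wf_fm B \<Longrightarrow> T \<turnstile> A \<^bold>\<and> B \<^bold>\<longrightarrow> B"
| disj_I1: "wf_fm A \<Longrightarrow> wf_fm B \<Longrightarrow> T \<turnstile> A \<^bold>\<longrightarrow> A \<^bold>\<or> B"
| disj_I2: "wf_fm A \<Longrightarrow> wf_fm B \<Longrightarrow> T \<turnstile> B \<^bold>\<longrightarrow> A \<^bold>\<or> B"
| disj_E: "wf_fm A \<Longrightarrow> wf_fm B \<Longrightarrow> wf_fm C \<Longrightarrow>
    T \<turnstile> (A \<^bold>\<longrightarrow> C) \<^bold>\<longrightarrow> (B \<^bold>\<longrightarrow> C) \<^bold>\<longrightarrow> A \<^bold>\<or> B \<^bold>\<longrightarrow> C"
| neg_I: "wf_fm A \<Longrightarrow> wf_fm B \<Longrightarrow> T \<turnstile> (A \<^bold>\<longrightarrow> B) \<^bold>\<longrightarrow> (A \<^bold>\<longrightarrow> \<^bold>\<not> B) \<^bold>\<longrightarrow> \<^bold>\<not> A"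
| neg_E: "wf_fm A \<Longrightarrow> wf_fm B \<Longrightarrow> T \<turnstile> \<^bold>\<not> A \<^bold>\<longrightarrow> A \<^bold>\<longrightarrow> B"
| allN_I: "T \<turnstile> shiftN_fm C \<^bold>\<longrightarrow> A \<Longrightarrow> T \<turnstile> C \<^bold>\<longrightarrow> AllN A"
| allN_E: "wf_fm A \<Longrightarrow> wf_trm t \<Longrightarrow> T \<turnstile> AllN A \<^bold>\<longrightarrow> instN A t"
| exN_I: "wf_fm A \<Longrightarrow> wf_trm t \<Longrightarrow> T \<turnstile> instN A t \<^bold>\<longrightarrow> ExN A"
| exN_E: "T \<turnstile> A \<^bold>\<longrightarrow> shiftN_fm C \<Longrightarrow> T \<turnstile> ExN A \<^bold>\<longrightarrow> C"
| allF_I: "T \<turnstile> shiftF_fm C \<^bold>\<longrightarrow> A \<Longrightarrow> T \<turnstile> C \<^bold>\<longrightarrow> AllF A"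
| allF_E: "wf_fm A \<Longrightarrow> wf_fctr u \<Longrightarrow> T \<turnstile> AllF A \<^bold>\<longrightarrow> instF A u"
| exF_I: "wf_fm A \<Longrightarrow> wf_fctr u \<Longrightarrow> T \<turnstile> instF A u \<^bold>\<longrightarrow> ExF A"
| exF_E: "T \<turnstile> A \<^bold>\<longrightarrow> shiftF_fm C \<Longrightarrow> T \<turnstile> ExF A \<^bold>\<longrightarrow> C"

section \<open>Schemata\<close>

abbreviation Ze :: "'c::lang trm" where "Ze \<equiv> Con cZero [] []"
abbreviation Sc :: "'c::lang trm \<Rightarrow> 'c trm" where "Sc t \<equiv> Ap (FC cSuc) t"
abbreviation Pl :: "'c::lang trm \<Rightarrow> 'c trm \<Rightarrow> 'c trm" where "Pl s t \<equiv> Con cPlus [s, t] []"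

definition Less :: "'c::lang trm \<Rightarrow> 'c trm \<Rightarrow> 'c fm" where
  "Less s t = ExN (Pl (Sc (NV 0)) (shiftN_trm s) \<^bold>= shiftN_trm t)"

definition Leq :: "'c::lang trm \<Rightarrow> 'c trm \<Rightarrow> 'c fm" where
  "Leq s t = (Less s t \<^bold>\<or> s \<^bold>= t)"

definition Iff :: "'c fm \<Rightarrow> 'c fm \<Rightarrow> 'c fm" where
  "Iff A B = ((A \<^bold>\<longrightarrow> B) \<^bold>\<and> (B \<^bold>\<longrightarrow> A))"

text \<open>\<open>A(0) \<and> \<forall>x (A(x) \<longrightarrow> A(Sx)) \<longrightarrow> \<forall>x A(x)\<close>, where \<open>x\<close> is the number index 0 of \<open>A\<close>.\<close>

definition induction_instance :: "'c::lang fm \<Rightarrow> 'c fm" where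
  "induction_instance A =
     (instN A Ze \<^bold>\<and> AllN (A \<^bold>\<longrightarrow> subst_fm (case_nat (Sc (NV 0)) (\<lambda>i. NV (Suc i))) FV A)
      \<^bold>\<longrightarrow> AllN A)"

text \<open>
  \<open>\<forall>x \<exists>y A(x,y) \<longrightarrow> \<exists>\<alpha> \<forall>x A(x, \<alpha>(x))\<close>, where \<open>y\<close> and \<open>x\<close> are the number indices 0 and 1 of \<open>A\<close>; the
  function indices of \<open>A\<close> are shifted, so \<open>\<alpha>\<close> does not occur in it.
\<close>

definition AC00_instance :: "'c fm \<Rightarrow> 'c fm" where
  "AC00_instance A =
     (AllN (ExN A) \<^bold>\<longrightarrow>
      ExF (AllN (subst_fm (case_nat (Ap (FV 0) (NV 0)) NV) (\<lambda>i. FV (Suc i)) A)))"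

definition QF_AC00 :: "'c::lang fm set" where
  "QF_AC00 = {AC00_instance A | A. wf_fm A \<and> quantifier_free A}"

text \<open>
  \<open>\<forall>x (B(x) \<or> \<not> B(x)) \<longrightarrow> \<exists>\<beta> \<forall>x (\<beta>(x) \<le> 1 \<and> (\<beta>(x) = 0 \<longleftrightarrow> B(x)))\<close>, where \<open>x\<close> is the number index 0
  of \<open>B\<close>, which may contain further free variables of both sorts.
\<close>

definition CF_d_instance :: "'c::lang fm \<Rightarrow> 'c fm" where
  "CF_d_instance B =
     (AllN (B \<^bold>\<or> \<^bold>\<not> B) \<^bold>\<longrightarrow>
      ExF (AllN (Leq (Ap (FV 0) (NV 0)) (Sc Ze) \<^bold>\<and>
                 Iff (Ap (FV 0) (NV 0) \<^bold>= Ze) (shiftF_fm B))))"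

definition CF_d :: "'c::lang fm set" where
  "CF_d = {CF_d_instance B | B. wf_fm B}"

section \<open>The system \<open>IA\<^sub>1\<close>\<close>

datatype ia_const =
    IZero | ISuc | IPlus | ITimes | IPow | IFact | IMonus | IPred | IMin | IMax | ISgbar | ISg
  | IAbsdiff | IRem | IQuot | ISum | IProd | IBMin | IBMax | IPrime | IExpo | ILh | IConc
  | IBar | ITilde | ICirc | ICcp

instantiation ia_const :: lang
begin

definition arity_ia_const :: "ia_const \<Rightarrow> (nat \<times> nat) option" where
  "arity_ia_const c =
     (if c = IZero then Some (0, 0)
      else if c \<in> {ISuc, IFact, IPred, ISgbar, ISg, IPrime, ILh} then Some (1, 0)
      else if c \<in> {ISum, IProd, IBMin, IBMax, IBar, ITilde, ICcp} then Some (1, 1)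
      else Some (2, 0))"

definition cZero_ia_const :: ia_const where "cZero_ia_const = IZero"
definition cSuc_ia_const :: ia_const where "cSuc_ia_const = ISuc"
definition cPlus_ia_const :: ia_const where "cPlus_ia_const = IPlus"

instance ..

end

type_synonym ia_trm = "ia_const trm"

abbreviation con1 :: "ia_const \<Rightarrow> ia_trm \<Rightarrow> ia_trm" where "con1 c s \<equiv> Ap (FC c) s"
abbreviation con2 :: "ia_const \<Rightarrow> ia_trm \<Rightarrow> ia_trm \<Rightarrow> ia_trm" where "con2 c s t \<equiv> Con c [s, t] []"
abbreviation conF :: "ia_const \<Rightarrow> ia_trm \<Rightarrow> ia_const fctr \<Rightarrow> ia_trm" where "conF c s u \<equiv> Con c [s] [u]"

abbreviation iOne :: ia_trm where "iOne \<equiv> con1 ISuc (Con IZero [] [])"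
abbreviation iTwo :: ia_trm where "iTwo \<equiv> con1 ISuc iOne"

text \<open>
  Kleene's bounded least number operator \<open>\<mu>x<z. r(x) = 0\<close> as \<open>\<Sum>x<z. \<Prod>s<x+1. r(s)\<close>, for \<open>r\<close> with
  values in \<open>{0, 1}\<close>; in \<open>r\<close> the number index 0 is bound, in \<open>z\<close> it is not. The value is \<open>z\<close> if there
  is no such \<open>x\<close>.
\<close>

definition bounded_mu :: "ia_trm \<Rightarrow> ia_trm \<Rightarrow> ia_trm" where
  "bounded_mu z r = conF ISum z (Lam (conF IProd (con1 ISuc (NV 0)) (shiftN_fctr (Lam r))))"

text \<open>
  A term with values in \<open>{0, 1}\<close> that is 0 iff \<open>w < v\<close>, \<open>1 < v\<close> and no \<open>c\<close> with \<open>1 < c < v\<close> divides \<open>v\<close>.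
\<close>

definition prime_above :: "ia_trm \<Rightarrow> ia_trm \<Rightarrow> ia_trm" where
  "prime_above w v =
     con1 ISg
       (con2 IPlus (con1 ISgbar (con2 IMonus v w))
         (con2 IPlus (con1 ISgbar (con2 IMonus v iOne))
           (conF ISum v
             (Lam (con2 ITimes (con1 ISg (con2 IMonus (NV 0) iOne))
                               (con1 ISgbar (con2 IRem (shiftN_trm v) (NV 0))))))))"

text \<open>
  The axioms, stated with free variables, from which all substitution instances are derivable;
  replacement for arbitrary terms follows from \<open>eq_ap\<close> and \<open>lambda_conv\<close>. In the defining
  equations \<open>a\<close>, \<open>b\<close> and \<open>\<alpha>\<close> are the variables \<open>NV 0\<close>, \<open>NV 1\<close> and \<open>FV 0\<close>; under one \<open>Lam\<close> they become \<open>NV 1\<close>, \<open>NV 2\<close> and \<open>FV 0\<close>.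
\<close>

inductive_set IA1 :: "ia_const fm set" where
  ind: "wf_fm A \<Longrightarrow> induction_instance A \<in> IA1"
| lambda_conv: "wf_trm t \<Longrightarrow> wf_trm s \<Longrightarrow> (Ap (Lam t) s \<^bold>= instN_trm t s) \<in> IA1"
| eq_refl: "(NV 0 \<^bold>= NV 0) \<in> IA1"
| eq_trans: "(NV 0 \<^bold>= NV 1 \<^bold>\<longrightarrow> NV 0 \<^bold>= NV 2 \<^bold>\<longrightarrow> NV 1 \<^bold>= NV 2) \<in> IA1"
| eq_suc: "(NV 0 \<^bold>= NV 1 \<^bold>\<longrightarrow> con1 ISuc (NV 0) \<^bold>= con1 ISuc (NV 1)) \<in> IA1"
| eq_ap: "(NV 0 \<^bold>= NV 1 \<^bold>\<longrightarrow> Ap (FV 0) (NV 0) \<^bold>= Ap (FV 0) (NV 1)) \<in> IA1"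
| suc_inj: "(con1 ISuc (NV 0) \<^bold>= con1 ISuc (NV 1) \<^bold>\<longrightarrow> NV 0 \<^bold>= NV 1) \<in> IA1"
| suc_neq_zero: "(\<^bold>\<not> con1 ISuc (NV 0) \<^bold>= Ze) \<in> IA1"
| plus_zero: "(con2 IPlus (NV 0) Ze \<^bold>= NV 0) \<in> IA1"
| plus_suc: "(con2 IPlus (NV 0) (con1 ISuc (NV 1)) \<^bold>= con1 ISuc (con2 IPlus (NV 0) (NV 1))) \<in> IA1"
| times_zero: "(con2 ITimes (NV 0) Ze \<^bold>= Ze) \<in> IA1"
| times_suc: "(con2 ITimes (NV 0) (con1 ISuc (NV 1))
      \<^bold>= con2 IPlus (con2 ITimes (NV 0) (NV 1)) (NV 0)) \<in> IA1"
| pow_zero: "(con2 IPow (NV 0) Ze \<^bold>= iOne) \<in> IA1"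
| pow_suc: "(con2 IPow (NV 0) (con1 ISuc (NV 1))
      \<^bold>= con2 ITimes (con2 IPow (NV 0) (NV 1)) (NV 0)) \<in> IA1"
| fact_zero: "(con1 IFact Ze \<^bold>= iOne) \<in> IA1"
| fact_suc: "(con1 IFact (con1 ISuc (NV 0))
      \<^bold>= con2 ITimes (con1 IFact (NV 0)) (con1 ISuc (NV 0))) \<in> IA1"
| pred_zero: "(con1 IPred Ze \<^bold>= Ze) \<in> IA1"
| pred_suc: "(con1 IPred (con1 ISuc (NV 0)) \<^bold>= NV 0) \<in> IA1"
| monus_zero: "(con2 IMonus (NV 0) Ze \<^bold>= NV 0) \<in> IA1"
| monus_suc: "(con2 IMonus (NV 0) (con1 ISuc (NV 1))
      \<^bold>= con1 IPred (con2 IMonus (NV 0) (NV 1))) \<in> IA1"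
| min_eq: "(con2 IMin (NV 0) (NV 1) \<^bold>= con2 IMonus (NV 1) (con2 IMonus (NV 1) (NV 0))) \<in> IA1"
| max_eq: "(con2 IMax (NV 0) (NV 1) \<^bold>= con2 IPlus (con2 IMonus (NV 0) (NV 1)) (NV 1)) \<in> IA1"
| sgbar_zero: "(con1 ISgbar Ze \<^bold>= iOne) \<in> IA1"
| sgbar_suc: "(con1 ISgbar (con1 ISuc (NV 0)) \<^bold>= Ze) \<in> IA1"
| sg_zero: "(con1 ISg Ze \<^bold>= Ze) \<in> IA1"
| sg_suc: "(con1 ISg (con1 ISuc (NV 0)) \<^bold>= iOne) \<in> IA1"
| absdiff_eq: "(con2 IAbsdiff (NV 0) (NV 1)
      \<^bold>= con2 IPlus (con2 IMonus (NV 0) (NV 1)) (con2 IMonus (NV 1) (NV 0))) \<in> IA1"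
| rem_zero: "(con2 IRem Ze (NV 1) \<^bold>= Ze) \<in> IA1"
| rem_suc: "(con2 IRem (con1 ISuc (NV 0)) (NV 1)
      \<^bold>= con2 ITimes (con1 ISuc (con2 IRem (NV 0) (NV 1)))
           (con1 ISg (con2 IAbsdiff (NV 1) (con1 ISuc (con2 IRem (NV 0) (NV 1)))))) \<in> IA1"
| quot_zero: "(con2 IQuot Ze (NV 1) \<^bold>= Ze) \<in> IA1"
| quot_suc: "(con2 IQuot (con1 ISuc (NV 0)) (NV 1)
      \<^bold>= con2 IPlus (con2 IQuot (NV 0) (NV 1))
           (con1 ISgbar (con2 IAbsdiff (NV 1) (con1 ISuc (con2 IRem (NV 0) (NV 1)))))) \<in> IA1"
| sum_zero: "(conF ISum Ze (FV 0) \<^bold>= Ze) \<in> IA1"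
| sum_suc: "(conF ISum (con1 ISuc (NV 0)) (FV 0)
      \<^bold>= con2 IPlus (conF ISum (NV 0) (FV 0)) (Ap (FV 0) (NV 0))) \<in> IA1"
| prod_zero: "(conF IProd Ze (FV 0) \<^bold>= iOne) \<in> IA1"
| prod_suc: "(conF IProd (con1 ISuc (NV 0)) (FV 0)
      \<^bold>= con2 ITimes (conF IProd (NV 0) (FV 0)) (Ap (FV 0) (NV 0))) \<in> IA1"
  \<comment> \<open>\<open>IBMin\<close> and \<open>IBMax\<close> are the minimum and maximum of \<open>\<alpha>(y)\<close> over \<open>y \<le> a\<close>.\<close>
| bmin_zero: "(conF IBMin Ze (FV 0) \<^bold>= Ap (FV 0) Ze) \<in> IA1"
| bmin_suc: "(conF IBMin (con1 ISuc (NV 0)) (FV 0)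
      \<^bold>= con2 IMin (conF IBMin (NV 0) (FV 0)) (Ap (FV 0) (con1 ISuc (NV 0)))) \<in> IA1"
| bmax_zero: "(conF IBMax Ze (FV 0) \<^bold>= Ap (FV 0) Ze) \<in> IA1"
| bmax_suc: "(conF IBMax (con1 ISuc (NV 0)) (FV 0)
      \<^bold>= con2 IMax (conF IBMax (NV 0) (FV 0)) (Ap (FV 0) (con1 ISuc (NV 0)))) \<in> IA1"
  \<comment> \<open>\<open>p\<^sub>0 = 2\<close>; \<open>p\<close> at \<open>a + 1\<close> is the least prime \<open>x\<close> above \<open>p\<^sub>a\<close>, searched below \<open>p\<^sub>a! + 2\<close>.\<close>
| prime_zero: "(con1 IPrime Ze \<^bold>= iTwo) \<in> IA1"
| prime_suc: "(con1 IPrime (con1 ISuc (NV 0))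
      \<^bold>= bounded_mu (con1 ISuc (con1 ISuc (con1 IFact (con1 IPrime (NV 0)))))
           (prime_above (con1 IPrime (NV 1)) (NV 0))) \<in> IA1"
  \<comment> \<open>The exponent of \<open>p\<^sub>b\<close> in \<open>a\<close>: the least \<open>x < a\<close> such that \<open>p\<^sub>b ^ x\<close> divides \<open>a\<close> and
    \<open>p\<^sub>b ^ (x + 1)\<close> does not.\<close>
| expo_eq: "(con2 IExpo (NV 0) (NV 1)
      \<^bold>= bounded_mu (NV 0)
           (con1 ISg (con2 IPlus
             (con2 IRem (NV 1) (con2 IPow (con1 IPrime (NV 2)) (NV 0)))
             (con1 ISgbar (con2 IRem (NV 1) (con2 IPow (con1 IPrime (NV 2)) (con1 ISuc (NV 0)))))))) \<in> IA1"
  \<comment> \<open>The number of nonvanishing exponents.\<close>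
| lh_eq: "(con1 ILh (NV 0)
      \<^bold>= conF ISum (NV 0) (Lam (con1 ISg (con2 IExpo (NV 1) (NV 0))))) \<in> IA1"
  \<comment> \<open>\<open>a * b = a \<cdot> (\<Prod>i<lh b. p\<^bsub>lh a + i\<^esub> ^ (b)\<^sub>i)\<close>\<close>
| conc_eq: "(con2 IConc (NV 0) (NV 1)
      \<^bold>= con2 ITimes (NV 0) (conF IProd (con1 ILh (NV 1))
           (Lam (con2 IPow (con1 IPrime (con2 IPlus (con1 ILh (NV 1)) (NV 0)))
                           (con2 IExpo (NV 2) (NV 0)))))) \<in> IA1"
  \<comment> \<open>The course of values of \<open>\<alpha>\<close> below \<open>a\<close>: \<open>\<Prod>i<a. p\<^sub>i ^ (\<alpha>(i) + 1)\<close> and \<open>\<Prod>i<a. p\<^sub>i ^ \<alpha>(i)\<close>.\<close>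
| bar_eq: "(conF IBar (NV 0) (FV 0)
      \<^bold>= conF IProd (NV 0)
           (Lam (con2 IPow (con1 IPrime (NV 0)) (con1 ISuc (Ap (FV 0) (NV 0)))))) \<in> IA1"
| tilde_eq: "(conF ITilde (NV 0) (FV 0)
      \<^bold>= conF IProd (NV 0) (Lam (con2 IPow (con1 IPrime (NV 0)) (Ap (FV 0) (NV 0))))) \<in> IA1"
  \<comment> \<open>\<open>a \<circ> b = (\<Prod>i<max a b. p\<^sub>i ^ max (a)\<^sub>i (b)\<^sub>i)\<close>; \<open>ccp\<close> is its iteration \<open>\<alpha>(0) \<circ> \<dots> \<circ> \<alpha>(a - 1)\<close>.\<close>
| circ_eq: "(con2 ICirc (NV 0) (NV 1)
      \<^bold>= conF IProd (con2 IMax (NV 0) (NV 1))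
           (Lam (con2 IPow (con1 IPrime (NV 0))
                  (con2 IMax (con2 IExpo (NV 1) (NV 0)) (con2 IExpo (NV 2) (NV 0)))))) \<in> IA1"
| ccp_zero: "(conF ICcp Ze (FV 0) \<^bold>= iOne) \<in> IA1"
| ccp_suc: "(conF ICcp (con1 ISuc (NV 0)) (FV 0)
      \<^bold>= con2 ICirc (conF ICcp (NV 0) (FV 0)) (Ap (FV 0) (NV 0))) \<in> IA1"

section \<open>The systems \<open>HA\<^sub>1\<close> and \<open>EL\<close>\<close>

text \<open>
  Primitive recursive descriptions, following Kleene's schemata: \<open>PConst n q\<close> is the \<open>n\<close>-place constant
  function \<open>q\<close>, \<open>PProj n i\<close> the projection of \<open>n\<close> arguments to the one at position \<open>i\<close> counted from 0,
  and recursion is on the first argument; \<open>PRec0\<close> is recursion without parameters.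
\<close>

datatype prd =
    PSuc
  | PConst nat nat
  | PProj nat nat
  | PComp prd "prd list"
  | PRec0 nat prd
  | PRec prd prd

primrec prd_arity :: "prd \<Rightarrow> nat" where
  "prd_arity PSuc = 1"
| "prd_arity (PConst n q) = n"
| "prd_arity (PProj n i) = n"
| "prd_arity (PComp f gs) = (case map prd_arity gs of [] \<Rightarrow> 0 | n # _ \<Rightarrow> n)"
| "prd_arity (PRec0 q h) = 1"
| "prd_arity (PRec g h) = Suc (prd_arity g)"

primrec wf_prd :: "prd \<Rightarrow> bool" where
  "wf_prd PSuc = True"
| "wf_prd (PConst n q) = (0 < n)"
| "wf_prd (PProj n i) = (i < n)"
| "wf_prd (PComp f gs) =
     (wf_prd f \<and> list_all (\<lambda>b. b) (map wf_prd gs) \<and> gs \<noteq> [] \<and> prd_arity f = length gs \<and>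
      (\<forall>g \<in> set gs. prd_arity g = prd_arity (hd gs)))"
| "wf_prd (PRec0 q h) = (wf_prd h \<and> prd_arity h = 2)"
| "wf_prd (PRec g h) = (wf_prd g \<and> wf_prd h \<and> prd_arity h = prd_arity g + 2)"

definition prd_plus :: prd where
  "prd_plus = PRec (PProj 1 0) (PComp PSuc [PProj 3 1])"

definition prd_times :: prd where
  "prd_times = PRec (PConst 1 0) (PComp prd_plus [PProj 3 1, PProj 3 2])"

text \<open>\<open>prd_pow\<close> takes the exponent as its first and the base as its second argument.\<close>

definition prd_pow :: prd where
  "prd_pow = PRec (PConst 1 1) (PComp prd_times [PProj 3 1, PProj 3 2])"

datatype el_const = EZero | EPr prd | ERec

instantiation el_const :: lang
begin

definition arity_el_const :: "el_const \<Rightarrow> (nat \<times> nat) option" where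
  "arity_el_const c =
     (case c of
        EZero \<Rightarrow> Some (0, 0)
      | EPr f \<Rightarrow> if wf_prd f then Some (prd_arity f, 0) else None
      | ERec \<Rightarrow> Some (2, 1))"

definition cZero_el_const :: el_const where "cZero_el_const = EZero"
definition cSuc_el_const :: el_const where "cSuc_el_const = EPr PSuc"
definition cPlus_el_const :: el_const where "cPlus_el_const = EPr prd_plus"

instance ..

end

type_synonym el_trm = "el_const trm"

text \<open>The term \<open>f(ts)\<close>, in the representation that is well-formed.\<close>

definition app_prd :: "prd \<Rightarrow> el_trm list \<Rightarrow> el_trm" where
  "app_prd f ts = (case ts of [t] \<Rightarrow> Ap (FC (EPr f)) t | _ \<Rightarrow> Con (EPr f) ts [])"

primrec el_numeral :: "nat \<Rightarrow> el_trm" where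
  "el_numeral 0 = Ze"
| "el_numeral (Suc n) = Sc (el_numeral n)"

abbreviation vars :: "nat \<Rightarrow> nat \<Rightarrow> el_trm list" where
  "vars m n \<equiv> map NV [m..<n]"

text \<open>\<open>\<langle>s, t\<rangle> = 2 ^ s \<cdot> 3 ^ t\<close>\<close>

definition el_pair :: "el_trm \<Rightarrow> el_trm \<Rightarrow> el_trm" where
  "el_pair s t =
     app_prd prd_times [app_prd prd_pow [s, el_numeral 2], app_prd prd_pow [t, el_numeral 3]]"

abbreviation el_rec :: "el_trm \<Rightarrow> el_const fctr \<Rightarrow> el_trm \<Rightarrow> el_trm" where
  "el_rec t u s \<equiv> Con ERec [t, s] [u]"

inductive_set HA1 :: "el_const fm set" where
  ind: "wf_fm A \<Longrightarrow> induction_instance A \<in> HA1"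
| lambda_conv: "wf_trm t \<Longrightarrow> wf_trm s \<Longrightarrow> (Ap (Lam t) s \<^bold>= instN_trm t s) \<in> HA1"
| eq_refl: "(NV 0 \<^bold>= NV 0) \<in> HA1"
| eq_replacement: "wf_fm A \<Longrightarrow> (instN A (NV i) \<^bold>\<and> NV i \<^bold>= NV j \<^bold>\<longrightarrow> instN A (NV j)) \<in> HA1"
| suc_neq_zero: "(\<^bold>\<not> Sc Ze \<^bold>= Ze) \<in> HA1"
| const_eq: "wf_prd (PConst n q) \<Longrightarrow> (app_prd (PConst n q) (vars 0 n) \<^bold>= el_numeral q) \<in> HA1"
| proj_eq: "wf_prd (PProj n i) \<Longrightarrow> (app_prd (PProj n i) (vars 0 n) \<^bold>= NV i) \<in> HA1"
| comp_eq: "wf_prd (PComp f gs) \<Longrightarrow> n = prd_arity (PComp f gs) \<Longrightarrow>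
    (app_prd (PComp f gs) (vars 0 n) \<^bold>= app_prd f (map (\<lambda>g. app_prd g (vars 0 n)) gs)) \<in> HA1"
| rec0_zero: "wf_prd (PRec0 q h) \<Longrightarrow> (app_prd (PRec0 q h) [Ze] \<^bold>= el_numeral q) \<in> HA1"
| rec0_suc: "wf_prd (PRec0 q h) \<Longrightarrow>
    (app_prd (PRec0 q h) [Sc (NV 0)] \<^bold>= app_prd h [NV 0, app_prd (PRec0 q h) [NV 0]]) \<in> HA1"
| rec_zero: "wf_prd (PRec g h) \<Longrightarrow> n = prd_arity (PRec g h) \<Longrightarrow>
    (app_prd (PRec g h) (Ze # vars 1 n) \<^bold>= app_prd g (vars 1 n)) \<in> HA1"
| rec_suc: "wf_prd (PRec g h) \<Longrightarrow> n = prd_arity (PRec g h) \<Longrightarrow>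
    (app_prd (PRec g h) (Sc (NV 0) # vars 1 n)
      \<^bold>= app_prd h (NV 0 # app_prd (PRec g h) (NV 0 # vars 1 n) # vars 1 n)) \<in> HA1"
| recursor_zero: "wf_trm t \<Longrightarrow> wf_fctr u \<Longrightarrow> (el_rec t u Ze \<^bold>= t) \<in> HA1"
| recursor_suc: "wf_trm t \<Longrightarrow> wf_fctr u \<Longrightarrow> wf_trm s \<Longrightarrow>
    (el_rec t u (Sc s) \<^bold>= Ap u (el_pair (el_rec t u s) s)) \<in> HA1"

definition EL :: "el_const fm set" where
  "EL = HA1 \<union> QF_AC00"

end

theory Submission
  imports Defs "HOL-Library.Countable" "HOL.Filter"
begin

text \<open>
  Over classical logic \<open>CF\<^sub>d\<close> is comprehension for arbitrary formulas. It fails in an \<open>\<omega>\<close>-model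
  whose functions are those computable from a fixed oracle, while such a model satisfies
  \<open>QF-AC\<^sub>0\<^sub>0\<close> by unbounded search. The oracle is chosen such that the halting
  problem relative to it is definable without any coding of computations in the formal languages:
  at \<open>\<langle>s, x\<rangle>\<close> it is 1 iff program \<open>x\<close>, run on \<open>x\<close> with the oracle
  restricted to arguments below \<open>\<langle>s, x\<rangle>\<close>, has value 1. A terminating computation uses only a
  finite part of the oracle, so \<open>\<exists>s. oracle \<langle>s, x\<rangle> = 1\<close> says that program \<open>x\<close> has value
  1 on \<open>x\<close>, and no computable \<open>\<beta>\<close> with values in \<open>{0, 1}\<close> vanishes exactly there.
\<close>

section \<open>Programs with an oracle\<close>

text \<open>In \<open>At\<close>, \<open>Inl\<close> is a de Bruijn variable and \<open>Inr\<close> a numeral. \<open>Rec\<close> binds the counter 0 and the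
  previous value 1 in its second argument, \<open>Mu\<close> binds 0.\<close>

datatype prog = At "nat + nat" | Succ prog | Orc prog | Rec prog prog prog | Mu prog

instance prog :: countable
  by countable_datatype

primrec atom :: "(nat \<Rightarrow> nat) \<Rightarrow> nat + nat \<Rightarrow> nat" where
  "atom e (Inl i) = e i"
| "atom e (Inr c) = c"

text \<open>Partial minimization: the search diverges as soon as some value before the first zero is
  undefined.\<close>

definition first_zero :: "(nat \<Rightarrow> nat option) \<Rightarrow> nat option" where
  "first_zero f =
     (if \<exists>y. f y = Some 0 \<and> (\<forall>z<y. \<exists>v. f z = Some (Suc v)) then Some (LEAST y. f y = Some 0) else None)"

lemma first_zero_eq_Some:
  "first_zero f = Some y \<longleftrightarrow> f y = Some 0 \<and> (\<forall>z<y. \<exists>v. f z = Some (Suc v))"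
proof -
  have least: "(LEAST y. f y = Some 0) = y" if "f y = Some 0" "\<forall>z<y. \<exists>v. f z = Some (Suc v)" for y
    using that by (intro Least_equality) (auto simp: not_less[symmetric])
  then show ?thesis
    unfolding first_zero_def by (auto split: if_splits)
qed

abbreviation push :: "nat \<Rightarrow> (nat \<Rightarrow> nat) \<Rightarrow> nat \<Rightarrow> nat" where
  "push x e \<equiv> case_nat x e"

text \<open>Divergence is \<open>None\<close>, and whether a search ends is decided in the
  metalanguage, so structural recursion suffices and no step counter occurs. The oracle is partial
  so that it can be cut down to finitely many arguments.\<close>

primrec run :: "(nat \<Rightarrow> nat option) \<Rightarrow> prog \<Rightarrow> (nat \<Rightarrow> nat) \<Rightarrow> nat option" where
  "run Q (At a) e = Some (atom e a)"
| "run Q (Succ p) e = map_option Suc (run Q p e)"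
| "run Q (Orc p) e = Option.bind (run Q p e) Q"
| "run Q (Rec p q r) e = Option.bind (run Q r e)
     (rec_nat (run Q p e) (\<lambda>k v. Option.bind v (\<lambda>m. run Q q (push k (push m e)))))"
| "run Q (Mu p) e = first_zero (\<lambda>y. run Q p (push y e))"

text \<open>Monotonicity and continuity in the oracle are the cases of a principal filter and of
  \<open>sequentially\<close>.\<close>

lemma run_eventually:
  assumes "run Q p e = Some v"
    and "\<And>x y. Q x = Some y \<Longrightarrow> \<forall>\<^sub>F i in F. R i x = Some y"
  shows "\<forall>\<^sub>F i in F. run (R i) p e = Some v"
  using assms(1)
proof (induction p arbitrary: e v)
  case (At a)
  then show ?case by simp
next
  case (Succ p)
  then obtain u where "run Q p e = Some u" "v = Suc u" by auto
  then show ?case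
    using Succ.IH[of e u] by (auto elim: eventually_mono)
next
  case (Orc p)
  then obtain u where u: "run Q p e = Some u" "Q u = Some v" by (auto simp: bind_eq_Some_conv)
  from Orc.IH[OF u(1)] assms(2)[OF u(2)] show ?case
    by eventually_elim simp
next
  case (Rec p q r)
  let ?f = "\<lambda>Q. rec_nat (run Q p e) (\<lambda>k v. Option.bind v (\<lambda>m. run Q q (push k (push m e))))"
  from Rec.prems obtain n where n: "run Q r e = Some n" "?f Q n = Some v"
    by (auto simp: bind_eq_Some_conv)
  \<comment> \<open>Each of the finitely many rounds of the recursion contributes one eventual
    condition; they are collected by induction on the counter.\<close>
  have "\<forall>\<^sub>F i in F. ?f (R i) n = Some w" if "?f Q n = Some w" for n w
    using that
  proof (induction n arbitrary: w)
    case 0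
    then show ?case using Rec.IH(1) by simp
  next
    case (Suc n)
    then obtain u where u: "?f Q n = Some u" "run Q q (push n (push u e)) = Some w"
      by (auto simp: bind_eq_Some_conv)
    from Suc.IH[OF u(1)] Rec.IH(2)[OF u(2)] show ?case
      by eventually_elim simp
  qed
  from Rec.IH(3)[OF n(1)] this[OF n(2)] show ?case
    by eventually_elim simp
next
  case (Mu p)
  then have 0: "run Q p (push v e) = Some 0"
    and s: "\<forall>z<v. \<exists>u. run Q p (push z e) = Some (Suc u)"
    by (simp_all add: first_zero_eq_Some)
  \<comment> \<open>A successful search makes only finitely many unsuccessful tests, so their
    eventual conditions hold simultaneously.\<close>
  have "\<forall>\<^sub>F i in F. \<forall>z\<in>{..<v}. \<exists>u. run (R i) p (push z e) = Some (Suc u)"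
  proof (rule eventually_ball_finite)
    show "\<forall>z\<in>{..<v}. \<forall>\<^sub>F i in F. \<exists>u. run (R i) p (push z e) = Some (Suc u)"
    proof
      fix z assume "z \<in> {..<v}"
      then obtain u where "run Q p (push z e) = Some (Suc u)" using s by auto
      from Mu.IH[OF this] show "\<forall>\<^sub>F i in F. \<exists>u. run (R i) p (push z e) = Some (Suc u)"
        by eventually_elim blast
    qed
  qed simp
  with Mu.IH[OF 0] show ?case
    by eventually_elim (simp add: first_zero_eq_Some)
qed

lemma run_mono:
  assumes "run Q p e = Some v" and "Q \<subseteq>\<^sub>m Q'"
  shows "run Q' p e = Some v"
proof -
  \<comment> \<open>For a constant family on a one-point index set, holding eventually is plain
    truth.\<close>
  have "\<forall>\<^sub>F i in principal {()}. run Q' p e = Some v"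
    using assms(1) by (rule run_eventually) (use assms(2) in \<open>force simp: map_le_def eventually_principal\<close>)
  then show ?thesis by (simp add: eventually_principal)
qed

text \<open>The use principle: a single answer at \<open>x\<close> survives restriction to every
  \<open>n > x\<close>, and a halting run asks finitely often.\<close>

lemma run_restrict:
  assumes "run Q p e = Some v"
  shows "\<forall>\<^sub>F n in sequentially. run (Q |` {..<n}) p e = Some v"
  using assms
proof (rule run_eventually)
  show "\<forall>\<^sub>F n in sequentially. (Q |` {..<n}) x = Some y" if "Q x = Some y" for x y
    using eventually_gt_at_top[of x] by eventually_elim (simp add: that)
qed

section \<open>Instantiating the variables of programs\<close>

abbreviation lift_atom :: "(nat \<Rightarrow> nat + nat) \<Rightarrow> nat \<Rightarrow> nat + nat" where
  "lift_atom s \<equiv> case_nat (Inl 0) (\<lambda>i. map_sum Suc id (s i))"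

text \<open>Replacing variables by variables or numerals only covers renaming and the fixing of
  parameters. Composition with another program is obtained from \<open>Rec\<close> in
  \<open>computable_apply\<close>.\<close>

primrec inst_prog :: "(nat \<Rightarrow> nat + nat) \<Rightarrow> prog \<Rightarrow> prog" where
  "inst_prog s (At a) = At (case_sum s Inr a)"
| "inst_prog s (Succ p) = Succ (inst_prog s p)"
| "inst_prog s (Orc p) = Orc (inst_prog s p)"
| "inst_prog s (Rec p q r) = Rec (inst_prog s p) (inst_prog (lift_atom (lift_atom s)) q) (inst_prog s r)"
| "inst_prog s (Mu p) = Mu (inst_prog (lift_atom s) p)"

lemma atom_map_sum: "atom (push x e) (map_sum Suc id a) = atom e a"
  by (cases a) simp_all

lemma atom_lift_atom: "(\<lambda>i. atom (push x e) (lift_atom s i)) = push x (\<lambda>i. atom e (s i))"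
  by (rule ext) (simp add: atom_map_sum split: nat.split)

lemma atom_case_nat: "(\<lambda>i. atom e (case_nat a s i)) = push (atom e a) (\<lambda>i. atom e (s i))"
  by (rule ext) (simp split: nat.split)

lemma run_inst_prog: "run Q (inst_prog s p) e = run Q p (\<lambda>i. atom e (s i))"
proof (induction p arbitrary: s e)
  case (At a)
  then show ?case by (cases a) simp_all
qed (simp_all add: atom_lift_atom)

section \<open>The oracle and the functions computable from it\<close>

text \<open>The oracle answers questions about programs using the oracle. The self-reference is
  well-founded: at \<open>n\<close>, the oracle calls are restricted to arguments below \<open>n\<close>.\<close>

function orc :: "nat \<Rightarrow> nat" where
  "orc n =
     (let x = snd (prod_decode n)
      in of_bool (run (\<lambda>m. if m < n then Some (orc m) else None) (from_nat x) (\<lambda>_. x) = Some 1))"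
  by auto
termination
  by (relation "measure id") auto

declare orc.simps [simp del]

text \<open>Functions read a whole environment, which avoids keeping track of arities. Convergence
  is demanded everywhere, so only total functions arise.\<close>

definition computable :: "((nat \<Rightarrow> nat) \<Rightarrow> nat) \<Rightarrow> bool" where
  "computable h \<longleftrightarrow> (\<exists>p. \<forall>e. run (Some \<circ> orc) p e = Some (h e))"

definition recf :: "(nat \<Rightarrow> nat) set" where
  "recf = {f. computable (\<lambda>e. f (e 0))}"

lemma orc_eq_1:
  "orc n = 1 \<longleftrightarrow>
     run ((Some \<circ> orc) |` {..<n}) (from_nat (snd (prod_decode n))) (\<lambda>_. snd (prod_decode n)) = Some 1"
proof -
  have "(Some \<circ> orc) |` {..<n} = (\<lambda>m. if m < n then Some (orc m) else None)"
    by (auto simp: restrict_map_def)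
  then show ?thesis
    by (subst orc.simps) (simp add: Let_def)
qed

text \<open>Diagonalization at the code \<open>x\<close> of a program for \<open>f\<close>: some
  stage \<open>s\<close> is answered 1 exactly when that program returns 1 on \<open>x\<close>.
  Hence \<open>f x = 0\<close> iff \<open>f x = 1\<close>, impossible for a value in {0, 1}.\<close>

lemma diagonal_not_recf:
  assumes "\<And>x. f x \<le> 1" and "\<And>x. f x = 0 \<longleftrightarrow> (\<exists>s. orc (prod_encode (s, x)) = 1)"
  shows "f \<notin> recf"
proof
  assume "f \<in> recf"
  then obtain p where p: "run (Some \<circ> orc) p e = Some (f (e 0))" for e
    by (auto simp: recf_def computable_def)
  define x where "x = to_nat p"
  have orc: "orc (prod_encode (s, x)) = 1 \<longleftrightarrow>
      run ((Some \<circ> orc) |` {..<prod_encode (s, x)}) p (\<lambda>_. x) = Some 1" for s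
    unfolding orc_eq_1 by (simp add: x_def)
  have "(\<exists>s. orc (prod_encode (s, x)) = 1) \<longleftrightarrow> f x = 1"
  proof
    assume "\<exists>s. orc (prod_encode (s, x)) = 1"
    then obtain s where "run ((Some \<circ> orc) |` {..<prod_encode (s, x)}) p (\<lambda>_. x) = Some 1"
      using orc by blast
    then have "run (Some \<circ> orc) p (\<lambda>_. x) = Some 1"
      by (rule run_mono) (auto simp: map_le_def)
    then show "f x = 1" using p by simp
  next
    assume "f x = 1"
    then have "run (Some \<circ> orc) p (\<lambda>_. x) = Some 1" using p by simp
    from run_restrict[OF this] obtain s where
      "\<forall>n\<ge>s. run ((Some \<circ> orc) |` {..<n}) p (\<lambda>_. x) = Some 1"
      by (auto simp: eventually_sequentially)
    \<comment> \<open>A pair code is at least its first component, so the restriction at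
      \<open>prod_encode (s, x)\<close> already contains every oracle value used.\<close>
    then have "orc (prod_encode (s, x)) = 1" unfolding orc by (simp add: le_prod_encode_1)
    then show "\<exists>s. orc (prod_encode (s, x)) = 1" ..
  qed
  then show False using assms[of x] by auto
qed

section \<open>Closure properties of the computable functions\<close>

lemma computable_inst: "computable h \<Longrightarrow> computable (\<lambda>e. h (\<lambda>i. atom e (s i)))"
  unfolding computable_def by (metis run_inst_prog)

lemma computable_rename: "computable h \<Longrightarrow> computable (\<lambda>e. h (\<lambda>i. e (r i)))"
  using computable_inst[of h "\<lambda>i. Inl (r i)"] by simp

lemma computable_var: "computable (\<lambda>e. e i)"
  unfolding computable_def by (rule exI[of _ "At (Inl i)"]) simp

lemma computable_const: "computable (\<lambda>_. c)"
  unfolding computable_def by (rule exI[of _ "At (Inr c)"]) simp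

lemma computable_Suc:
  assumes "computable h" shows "computable (\<lambda>e. Suc (h e))"
proof -
  obtain p where "\<And>e. run (Some \<circ> orc) p e = Some (h e)" using assms by (auto simp: computable_def)
  then show ?thesis unfolding computable_def by (intro exI[of _ "Succ p"]) simp
qed

lemma computable_orc:
  assumes "computable h" shows "computable (\<lambda>e. orc (h e))"
proof -
  obtain p where "\<And>e. run (Some \<circ> orc) p e = Some (h e)" using assms by (auto simp: computable_def)
  then show ?thesis unfolding computable_def by (intro exI[of _ "Orc p"]) simp
qed

text \<open>In \<open>f (\<lambda>i. e (Suc i)) (e 0)\<close> variable 0 is the searched one and the
  others move down: this is how the body of \<open>Mu\<close> sees its environment. The second
  hypothesis makes the search converge.\<close>

lemma computable_Least:
  assumes "computable (\<lambda>e. f (\<lambda>i. e (Suc i)) (e 0))" and "\<And>e. \<exists>y. f e y = (0::nat)"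
  shows "computable (\<lambda>e. LEAST y. f e y = 0)"
proof -
  obtain p where p: "\<And>e. run (Some \<circ> orc) p e = Some (f (\<lambda>i. e (Suc i)) (e 0))"
    using assms(1) by (auto simp: computable_def)
  have "run (Some \<circ> orc) (Mu p) e = Some (LEAST y. f e y = 0)" for e
  proof -
    have "f e (LEAST y. f e y = 0) = 0"
      using assms(2) by (rule LeastI_ex)
    moreover have "\<exists>v. f e z = Suc v" if "z < (LEAST y. f e y = 0)" for z
      using not_less_Least[OF that] by (rule not0_implies_Suc)
    ultimately show ?thesis by (simp add: first_zero_eq_Some p)
  qed
  then show ?thesis unfolding computable_def by blast
qed

lemma computable_rec:
  assumes "computable a" and "computable (\<lambda>e. f (\<lambda>i. e (Suc (Suc i))) (e 0) (e 1))" and "computable c"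
  shows "computable (\<lambda>e. rec_nat (a e) (f e) (c e))"
proof -
  obtain p q r where p: "\<And>e. run (Some \<circ> orc) p e = Some (a e)"
    and q: "\<And>e. run (Some \<circ> orc) q e = Some (f (\<lambda>i. e (Suc (Suc i))) (e 0) (e 1))"
    and r: "\<And>e. run (Some \<circ> orc) r e = Some (c e)"
    using assms by (auto simp: computable_def)
  have "rec_nat (run (Some \<circ> orc) p e)
      (\<lambda>k v. Option.bind v (\<lambda>m. run (Some \<circ> orc) q (push k (push m e)))) n
    = Some (rec_nat (a e) (f e) n)" for e n
    by (induction n) (simp_all add: p q del: comp_apply)
  then have "run (Some \<circ> orc) (Rec p q r) e = Some (rec_nat (a e) (f e) (c e))" for e
    by (simp add: r)
  then show ?thesis unfolding computable_def by blast
qed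

text \<open>\<open>uniform u\<close> says that \<open>u e\<close> is computable uniformly in \<open>e\<close>; the argument becomes the
  variable 0.\<close>

definition uniform :: "((nat \<Rightarrow> nat) \<Rightarrow> nat \<Rightarrow> nat) \<Rightarrow> bool" where
  "uniform u \<longleftrightarrow> computable (\<lambda>e. u (\<lambda>i. e (Suc i)) (e 0))"

lemma uniform_rename: "uniform u \<Longrightarrow> uniform (\<lambda>e. u (\<lambda>i. e (r i)))"
  unfolding uniform_def
  using computable_rename[of "\<lambda>e. u (\<lambda>i. e (Suc i)) (e 0)" "case_nat 0 (\<lambda>i. Suc (r i))"] by simp

lemma uniform_const: "f \<in> recf \<Longrightarrow> uniform (\<lambda>_. f)"
  by (simp add: uniform_def recf_def)

text \<open>A recursion that ignores its previous value and takes \<open>Suc (a e)\<close> rounds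
  has its last round at counter \<open>a e\<close>, so it evaluates \<open>u e\<close>
  there.\<close>

lemma computable_apply:
  assumes "uniform u" and "computable a" shows "computable (\<lambda>e. u e (a e))"
proof -
  have "computable (\<lambda>e. rec_nat 0 (\<lambda>k _. u e k) (Suc (a e)))"
    \<comment> \<open>The renaming \<open>case_nat 0 (\<lambda>i. Suc (Suc i))\<close> keeps the
      counter at 0 and skips variable 1, the previous value.\<close>
    by (rule computable_rec[where f = "\<lambda>e k _. u e k"])
      (use uniform_rename[OF assms(1), of Suc] computable_rename[OF assms(1)[unfolded uniform_def],
          of "case_nat 0 (\<lambda>i. Suc (Suc i))"]
        in \<open>simp_all add: computable_const computable_Suc assms\<close>)
  then show ?thesis by simp
qed

lemma computable_apply_rename:
  "uniform u \<Longrightarrow> computable a \<Longrightarrow> computable (\<lambda>e. u (\<lambda>i. e (r i)) (a e))"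
  by (rule computable_apply[OF uniform_rename])

lemma computable_fun: "f \<in> recf \<Longrightarrow> computable a \<Longrightarrow> computable (\<lambda>e. f (a e))"
  using computable_apply[OF uniform_const] by simp

lemma computable_fun2:
  assumes "computable (\<lambda>e. f (e 0) (e 1))" and "computable a" and "computable b"
  shows "computable (\<lambda>e. f (a e) (b e))"
proof -
  have "uniform (\<lambda>e x. f x (e 0))"
    using assms(1) by (simp add: uniform_def)
  \<comment> \<open>The second argument waits as variable 0 while \<open>a\<close>, shifted past it,
    is substituted for the first.\<close>
  from computable_apply[OF this computable_rename[OF assms(2), of Suc]]
  have "uniform (\<lambda>e. f (a e))"
    by (simp add: uniform_def)
  from computable_apply[OF this assms(3)] show ?thesis .
qed

section \<open>Arithmetic on computable functions\<close>

named_theorems computable_intros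

lemmas [computable_intros] = computable_var computable_const computable_Suc

lemma computable_add [computable_intros]:
  assumes "computable a" and "computable b" shows "computable (\<lambda>e. a e + b e)"
proof -
  have "x + y = rec_nat x (\<lambda>_. Suc) y" for x y :: nat by (induction y) auto
  moreover have "computable (\<lambda>e. rec_nat (a e) (\<lambda>_. Suc) (b e))"
    by (rule computable_rec) (intro assms computable_intros)+
  ultimately show ?thesis by simp
qed

lemma computable_mult [computable_intros]:
  assumes "computable a" and "computable b" shows "computable (\<lambda>e. a e * b e)"
proof -
  have eq: "x * y = rec_nat 0 (\<lambda>_ r. r + x) y" for x y :: nat by (induction y) auto
  have "computable (\<lambda>e. e 0 * e 1)"
    unfolding eq by (rule computable_rec) (intro computable_intros)+
  from computable_fun2[OF this assms] show ?thesis .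
qed

lemma computable_power [computable_intros]:
  assumes "computable a" and "computable b" shows "computable (\<lambda>e. a e ^ b e)"
proof -
  have eq: "x ^ y = rec_nat 1 (\<lambda>_ r. r * x) y" for x y :: nat by (induction y) auto
  have "computable (\<lambda>e. e 0 ^ e 1)"
    unfolding eq by (rule computable_rec) (intro computable_intros)+
  from computable_fun2[OF this assms] show ?thesis .
qed

lemma computable_diff [computable_intros]:
  assumes "computable a" and "computable b" shows "computable (\<lambda>e. a e - b e)"
proof -
  have pred: "x - 1 = rec_nat 0 (\<lambda>k _. k) x" for x :: nat by (cases x) auto
  have "(\<lambda>x. x - 1) \<in> recf"
    unfolding recf_def pred by (simp, rule computable_rec) (intro computable_intros)+
  note [computable_intros] = computable_fun[OF this]
  have eq: "rec_nat x (\<lambda>_ r. r - 1) y = x - y" for x y :: nat by (induction y) auto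
  have "computable (\<lambda>e. rec_nat (a e) (\<lambda>_ r. r - 1) (b e))"
    by (rule computable_rec) (intro assms computable_intros)+
  then show ?thesis unfolding eq .
qed

lemma computable_of_bool_eq [computable_intros]:
  assumes "computable a" and "computable b" shows "computable (\<lambda>e. of_bool (a e = b e))"
proof -
  have "of_bool (x = y) = 1 - ((x - y) + (y - x))" for x y :: nat by auto
  moreover have "computable (\<lambda>e. 1 - ((a e - b e) + (b e - a e)))"
    by (intro assms computable_intros)
  ultimately show ?thesis by simp
qed

lemma computable_of_bool_not [computable_intros]:
  assumes "computable (\<lambda>e. of_bool (P e))" shows "computable (\<lambda>e. of_bool (\<not> P e))"
proof -
  have "of_bool (\<not> p) = (1::nat) - of_bool p" for p by simp
  then show ?thesis by (simp only:) (intro assms computable_intros)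
qed

lemma computable_of_bool_conj [computable_intros]:
  assumes "computable (\<lambda>e. of_bool (P e))" and "computable (\<lambda>e. of_bool (Q e))"
  shows "computable (\<lambda>e. of_bool (P e \<and> Q e))"
  unfolding of_bool_conj by (intro assms computable_intros)

lemma computable_min [computable_intros]:
  assumes "computable a" and "computable b" shows "computable (\<lambda>e. min (a e) (b e))"
proof -
  have "min x y = y - (y - x)" for x y :: nat by auto
  then show ?thesis by (simp only:) (intro assms computable_intros)
qed

lemma computable_max [computable_intros]:
  assumes "computable a" and "computable b" shows "computable (\<lambda>e. max (a e) (b e))"
proof -
  have "max x y = (x - y) + y" for x y :: nat by auto
  then show ?thesis by (simp only:) (intro assms computable_intros)
qed

lemma computable_fact [computable_intros]:
  assumes "computable a" shows "computable (\<lambda>e. fact (a e))"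
proof -
  have eq: "fact x = rec_nat 1 (\<lambda>k r. r * Suc k) x" for x :: nat by (induction x) auto
  show ?thesis
    unfolding eq by (rule computable_rec) (intro assms computable_intros)+
qed

lemma computable_sum:
  assumes "computable a" and "computable (\<lambda>e. f (\<lambda>i. e (Suc i)) (e 0))"
  shows "computable (\<lambda>e. \<Sum>y<a e. f e y)"
proof -
  have eq: "(\<Sum>y<n. g y) = rec_nat 0 (\<lambda>k r. r + g k) n" for n and g :: "nat \<Rightarrow> nat"
    by (induction n) auto
  show ?thesis
    unfolding eq
    by (rule computable_rec)
      (use computable_rename[OF assms(2), of "case_nat 0 (\<lambda>i. Suc (Suc i))"]
        in \<open>auto intro!: assms computable_intros\<close>)
qed

lemma computable_prod:
  assumes "computable a" and "computable (\<lambda>e. f (\<lambda>i. e (Suc i)) (e 0))"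
  shows "computable (\<lambda>e. \<Prod>y<a e. f e y)"
proof -
  have eq: "(\<Prod>y<n. g y) = rec_nat 1 (\<lambda>k r. r * g k) n" for n and g :: "nat \<Rightarrow> nat"
    by (induction n) auto
  show ?thesis
    unfolding eq
    by (rule computable_rec)
      (use computable_rename[OF assms(2), of "case_nat 0 (\<lambda>i. Suc (Suc i))"]
        in \<open>auto intro!: assms computable_intros\<close>)
qed

text \<open>With \<open>triangle\<close> available as a function parameter, pairing can be expressed
  without being defined in the formal languages.\<close>

lemma triangle_recf: "triangle \<in> recf"
proof -
  have eq: "triangle x = rec_nat 0 (\<lambda>k r. r + Suc k) x" for x
    by (induction x) auto
  show ?thesis
    unfolding recf_def eq by (simp, rule computable_rec) (intro computable_intros)+
qed

lemma orc_recf: "orc \<in> recf"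
  by (simp add: recf_def computable_orc computable_var)

section \<open>Classical semantics\<close>

type_synonym 'c interp = "'c \<Rightarrow> nat list \<Rightarrow> (nat \<Rightarrow> nat) list \<Rightarrow> nat"

primrec ev_trm :: "'c interp \<Rightarrow> (nat \<Rightarrow> nat) \<Rightarrow> (nat \<Rightarrow> nat \<Rightarrow> nat) \<Rightarrow> 'c trm \<Rightarrow> nat"
  and ev_fctr :: "'c interp \<Rightarrow> (nat \<Rightarrow> nat) \<Rightarrow> (nat \<Rightarrow> nat \<Rightarrow> nat) \<Rightarrow> 'c fctr \<Rightarrow> nat \<Rightarrow> nat" where
  "ev_trm I e r (NV i) = e i"
| "ev_trm I e r (Con c ts us) = I c (map (ev_trm I e r) ts) (map (ev_fctr I e r) us)"
| "ev_trm I e r (Ap u t) = ev_fctr I e r u (ev_trm I e r t)"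
| "ev_fctr I e r (FV i) = r i"
| "ev_fctr I e r (FC c) = (\<lambda>x. I c [x] [])"
| "ev_fctr I e r (Lam t) = (\<lambda>x. ev_trm I (push x e) r t)"

primrec sat :: "'c interp \<Rightarrow> (nat \<Rightarrow> nat) set \<Rightarrow> (nat \<Rightarrow> nat) \<Rightarrow> (nat \<Rightarrow> nat \<Rightarrow> nat) \<Rightarrow> 'c fm \<Rightarrow> bool" where
  "sat I F e r (s \<^bold>= t) \<longleftrightarrow> ev_trm I e r s = ev_trm I e r t"
| "sat I F e r (\<^bold>\<not> A) \<longleftrightarrow> \<not> sat I F e r A"
| "sat I F e r (A \<^bold>\<and> B) \<longleftrightarrow> sat I F e r A \<and> sat I F e r B"
| "sat I F e r (A \<^bold>\<or> B) \<longleftrightarrow> sat I F e r A \<or> sat I F e r B"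
| "sat I F e r (A \<^bold>\<longrightarrow> B) \<longleftrightarrow> (sat I F e r A \<longrightarrow> sat I F e r B)"
| "sat I F e r (AllN A) \<longleftrightarrow> (\<forall>x. sat I F (push x e) r A)"
| "sat I F e r (ExN A) \<longleftrightarrow> (\<exists>x. sat I F (push x e) r A)"
| "sat I F e r (AllF A) \<longleftrightarrow> (\<forall>f\<in>F. sat I F e (case_nat f r) A)"
| "sat I F e r (ExF A) \<longleftrightarrow> (\<exists>f\<in>F. sat I F e (case_nat f r) A)"

lemma case_nat_lift_ren: "(\<lambda>i. case_nat x e (lift_ren p i)) = case_nat x (\<lambda>i. e (p i))"
  by (rule ext) (simp split: nat.split)

lemma ev_ren:
  "ev_trm I e r (ren_trm p q t) = ev_trm I (\<lambda>i. e (p i)) (\<lambda>i. r (q i)) t"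
  "ev_fctr I e r (ren_fctr p q u) = ev_fctr I (\<lambda>i. e (p i)) (\<lambda>i. r (q i)) u"
proof (induction t and u arbitrary: e p and e p)
  case (Con c ts us)
  then show ?case by (simp add: comp_def cong: map_cong)
qed (simp_all add: case_nat_lift_ren)

lemma sat_ren: "sat I F e r (ren_fm p q A) = sat I F (\<lambda>i. e (p i)) (\<lambda>i. r (q i)) A"
  by (induction A arbitrary: e r p q) (simp_all add: ev_ren case_nat_lift_ren)

lemma ev_case_nat:
  "(\<lambda>i. ev_trm I e r (case_nat t s i)) = case_nat (ev_trm I e r t) (\<lambda>i. ev_trm I e r (s i))"
  "(\<lambda>i. ev_fctr I e r (case_nat u v i)) = case_nat (ev_fctr I e r u) (\<lambda>i. ev_fctr I e r (v i))"
  by (rule ext; simp split: nat.split)+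

lemma ev_subst:
  "ev_trm I e r (subst_trm s v t) = ev_trm I (\<lambda>i. ev_trm I e r (s i)) (\<lambda>i. ev_fctr I e r (v i)) t"
  "ev_fctr I e r (subst_fctr s v u) = ev_fctr I (\<lambda>i. ev_trm I e r (s i)) (\<lambda>i. ev_fctr I e r (v i)) u"
proof (induction t and u arbitrary: e s v and e s v)
  case (Con c ts us)
  then show ?case by (simp add: comp_def cong: map_cong)
qed (simp_all add: ev_case_nat ev_ren)

lemma sat_subst:
  "sat I F e r (subst_fm s v A) = sat I F (\<lambda>i. ev_trm I e r (s i)) (\<lambda>i. ev_fctr I e r (v i)) A"
  by (induction A arbitrary: e r s v) (simp_all add: ev_subst ev_ren ev_case_nat)

lemma ev_instN_trm: "ev_trm I e r (instN_trm s t) = ev_trm I (push (ev_trm I e r t) e) r s"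
  by (simp add: instN_trm_def ev_subst ev_case_nat)

lemma sat_instN: "sat I F e r (instN A t) = sat I F (push (ev_trm I e r t) e) r A"
  by (simp add: instN_def sat_subst ev_case_nat)

lemma sat_instF: "sat I F e r (instF A u) = sat I F e (case_nat (ev_fctr I e r u) r) A"
  by (simp add: instF_def sat_subst ev_case_nat)

definition valid :: "'c interp \<Rightarrow> (nat \<Rightarrow> nat) set \<Rightarrow> 'c fm \<Rightarrow> bool" where
  "valid I F A \<longleftrightarrow> (\<forall>e r. range r \<subseteq> F \<longrightarrow> sat I F e r A)"

lemma range_case_nat: "range (case_nat f r) \<subseteq> F \<longleftrightarrow> f \<in> F \<and> range r \<subseteq> F"
  by (auto simp: image_subset_iff split: nat.splits)

text \<open>Classical truth validates the intuitionistic rules. Closure of \<open>F\<close> under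
  functors is what \<open>allF_E\<close> and \<open>exF_I\<close> require, since they instantiate
  function quantifiers.\<close>

lemma soundness:
  assumes "T \<turnstile> A" and "\<And>B. B \<in> T \<Longrightarrow> valid I F B"
    and "\<And>u e r. wf_fctr u \<Longrightarrow> range r \<subseteq> F \<Longrightarrow> ev_fctr I e r u \<in> F"
  shows "valid I F A"
  using assms(1)
proof induction
  case (axiom A)
  then show ?case by (rule assms(2))
next
  case (allN_I C A)
  then show ?case by (fastforce simp: valid_def sat_ren)
next
  case (exN_E A C)
  then show ?case by (fastforce simp: valid_def sat_ren)
next
  case (allF_I C A)
  show ?case
    unfolding valid_def
  proof (intro allI impI)
    fix e and r :: "nat \<Rightarrow> nat \<Rightarrow> nat" assume r: "range r \<subseteq> F"
    have "sat I F e (case_nat f r) (shiftF_fm C \<^bold>\<longrightarrow> A)" if "f \<in> F" for f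
      using allF_I.IH r that unfolding valid_def by (simp only: range_case_nat)
    then show "sat I F e r (C \<^bold>\<longrightarrow> AllF A)" by (simp add: sat_ren)
  qed
next
  case (exF_E A C)
  show ?case
    unfolding valid_def
  proof (intro allI impI)
    fix e and r :: "nat \<Rightarrow> nat \<Rightarrow> nat" assume r: "range r \<subseteq> F"
    have "sat I F e (case_nat f r) (A \<^bold>\<longrightarrow> shiftF_fm C)" if "f \<in> F" for f
      using exF_E.IH r that unfolding valid_def by (simp only: range_case_nat)
    then show "sat I F e r (ExF A \<^bold>\<longrightarrow> C)" by (auto simp: sat_ren)
  qed
qed (use assms(3) in \<open>auto simp: valid_def sat_instN sat_instF\<close>)

section \<open>The model of functions computable from the oracle\<close>

text \<open>What the two systems share: the constants used in the schemata have their standard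
  meaning, and every constant acts effectively, also on its function arguments.\<close>

locale computable_model =
  fixes I :: "'c::lang interp"
  assumes arity_cZero: "arity (cZero :: 'c) = Some (0, 0)"
    and arity_cSuc: "arity (cSuc :: 'c) = Some (1, 0)"
    and arity_cPlus: "arity (cPlus :: 'c) = Some (2, 0)"
    and cZero_eq: "I cZero [] [] = 0"
    and cSuc_eq: "I cSuc [x] [] = Suc x"
    and cPlus_eq: "I cPlus [x, y] [] = x + y"
    and computable_con: "\<lbrakk>arity c = Some (length ts, length us);
      \<forall>t\<in>set ts. computable t; \<forall>u\<in>set us. uniform u\<rbrakk> \<Longrightarrow>
      computable (\<lambda>e. I c (map (\<lambda>t. t e) ts) (map (\<lambda>u. u e) us))"
begin

text \<open>Function parameters are fixed members of \<open>recf\<close> and enter through their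
  programs, while number variables stay inputs; so the body of a \<open>Lam\<close> is computable in
  the bound variable too.\<close>

lemma computable_ev:
  assumes "range r \<subseteq> recf"
  shows "wf_trm t \<Longrightarrow> computable (\<lambda>e. ev_trm I e r t)"
    and "wf_fctr u \<Longrightarrow> uniform (\<lambda>e. ev_fctr I e r u)"
proof (induction t and u)
  case (NV i)
  then show ?case by (simp add: computable_var)
next
  case (Con c ts us)
  have "computable (\<lambda>e. I c (map (\<lambda>t. t e) (map (\<lambda>t e. ev_trm I e r t) ts))
      (map (\<lambda>u. u e) (map (\<lambda>u e. ev_fctr I e r u) us)))"
    by (rule computable_con) (use Con in \<open>auto simp: list.pred_map list_all_iff\<close>)
  then show ?case by (simp add: comp_def)
next
  case (Ap u t)
  then show ?case using computable_apply[of "\<lambda>e. ev_fctr I e r u" "\<lambda>e. ev_trm I e r t"] by simp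
next
  case (FV i)
  then show ?case using assms by (auto intro: uniform_const)
next
  case (FC c)
  then show ?case
    using computable_con[of c "[\<lambda>e. e 0]" "[]"] by (simp add: uniform_def computable_var)
next
  case (Lam t)
  have "push (e 0) (\<lambda>i. e (Suc i)) = e" for e :: "nat \<Rightarrow> nat"
    by (rule ext) (simp split: nat.split)
  with Lam show ?case by (simp add: uniform_def)
qed

text \<open>The closure condition of \<open>soundness\<close>: the number parameters in
  \<open>e\<close> are hardwired as numerals, leaving the argument as the only input.\<close>

lemma ev_fctr_recf:
  assumes "wf_fctr u" and "range r \<subseteq> recf" shows "ev_fctr I e r u \<in> recf"
  using computable_inst[OF computable_ev(2)[OF assms(2,1), unfolded uniform_def],
      of "case_nat (Inl 0) (\<lambda>i. Inr (e i))"]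
  by (simp add: recf_def)

lemma computable_sat:
  assumes "range r \<subseteq> recf"
  shows "wf_fm A \<Longrightarrow> quantifier_free A \<Longrightarrow> computable (\<lambda>e. of_bool (sat I recf e r A))"
proof (induction A)
  case (Eq s t)
  then show ?case using computable_of_bool_eq[OF computable_ev(1) computable_ev(1)] assms by simp
next
  case (Neg A)
  then show ?case using computable_of_bool_not[of "\<lambda>e. sat I recf e r A"] by simp
next
  case (Conj A B)
  then show ?case
    using computable_of_bool_conj[of "\<lambda>e. sat I recf e r A" "\<lambda>e. sat I recf e r B"] by simp
next
  case (Disj A B)
  then have "computable (\<lambda>e. of_bool (\<not> (\<not> sat I recf e r A \<and> \<not> sat I recf e r B)))"
    by (intro computable_intros) auto
  then show ?case by simp
next
  case (Imp A B)
  then have "computable (\<lambda>e. of_bool (\<not> (sat I recf e r A \<and> \<not> sat I recf e r B)))"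
    by (intro computable_intros) auto
  then show ?case by simp
qed simp_all

text \<open>The matrix is decidable from the oracle by \<open>computable_sat\<close>, so the least
  witness is found by a search that the premise makes terminate.\<close>

lemma valid_QF_AC00:
  assumes "A \<in> QF_AC00" shows "valid I recf A"
proof -
  from assms obtain D where D: "A = AC00_instance D" "wf_fm D" "quantifier_free D"
    by (auto simp: QF_AC00_def)
  show ?thesis
    unfolding valid_def
  proof (intro allI impI)
    fix e and r :: "nat \<Rightarrow> nat \<Rightarrow> nat" assume r: "range r \<subseteq> recf"
    let ?P = "\<lambda>x y. sat I recf (push y (push x e)) r D"
    have "\<exists>f\<in>recf. \<forall>x. ?P x (f x)" if ex: "\<forall>x. \<exists>y. ?P x y"
    proof
      \<comment> \<open>Negated because \<open>computable_Least\<close> looks for a zero. The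
        searched \<open>y\<close> is variable 0, \<open>x\<close> is variable 1, and all number
        parameters become numerals.\<close>
      have "computable (\<lambda>d. of_bool (\<not> ?P (d 1) (d 0)))"
        using computable_of_bool_not[OF computable_inst[OF computable_sat[OF r D(2,3)],
            of "case_nat (Inl 0) (case_nat (Inl 1) (\<lambda>i. Inr (e i)))"]]
        by (simp add: atom_case_nat)
      then have "computable (\<lambda>d. LEAST y. of_bool (\<not> ?P (d 0) y) = (0::nat))"
        by (intro computable_Least) (use ex in auto)
      then show "(\<lambda>x. LEAST y. ?P x y) \<in> recf"
        by (simp add: recf_def)
      show "\<forall>x. ?P x (LEAST y. ?P x y)"
        using ex by (auto intro: LeastI_ex)
    qed
    then show "sat I recf e r A"
      by (simp add: D(1) AC00_instance_def sat_subst ev_case_nat)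
  qed
qed

lemma sat_Less: "sat I F e r (Less s t) \<longleftrightarrow> ev_trm I e r s < ev_trm I e r t"
proof -
  have "m < n \<longleftrightarrow> (\<exists>x. Suc x + m = n)" for m n :: nat
    by presburger
  then show ?thesis by (simp add: Less_def ev_ren cSuc_eq cPlus_eq)
qed

lemma sat_Leq: "sat I F e r (Leq s t) \<longleftrightarrow> ev_trm I e r s \<le> ev_trm I e r t"
  by (auto simp: Leq_def sat_Less)

text \<open>Number quantifiers range over the actual natural numbers, so induction holds for every
  formula whatever the function domain is.\<close>

lemma valid_induction_instance: "valid I recf (induction_instance A)"
  unfolding valid_def
proof (intro allI impI)
  fix e r
  have "sat I recf (push x e) r A"
    if "sat I recf (push 0 e) r A"
      and "\<forall>x. sat I recf (push x e) r A \<longrightarrow> sat I recf (push (Suc x) e) r A" for x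
    using that by (induction x) auto
  then have "sat I recf (push 0 e) r A \<and>
      (\<forall>x. sat I recf (push x e) r A \<longrightarrow> sat I recf (push (Suc x) e) r A) \<longrightarrow>
      (\<forall>x. sat I recf (push x e) r A)"
    by blast
  moreover have "sat I recf e r (induction_instance A) \<longleftrightarrow>
      (sat I recf (push 0 e) r A \<and>
      (\<forall>x. sat I recf (push x e) r A \<longrightarrow> sat I recf (push (Suc x) e) r A) \<longrightarrow>
      (\<forall>x. sat I recf (push x e) r A))"
    by (simp only: induction_instance_def sat.simps sat_instN sat_subst ev_case_nat cZero_eq cSuc_eq
        ev_trm.simps ev_fctr.simps list.map nat.case)
  ultimately show "sat I recf e r (induction_instance A)"
    by blast
qed

lemma valid_lambda_conv: "valid I recf (Ap (Lam t) s \<^bold>= instN_trm t s)"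
  by (simp add: valid_def ev_instN_trm)

text \<open>The number index 0 is the variable \<open>x\<close> of \<open>CF\<^sub>d\<close> outside and \<open>s\<close> inside \<open>ExN\<close>; the function
  indices 0 and 1 stand for the oracle and for \<open>triangle\<close>, by which the argument is
  \<open>prod_encode (s, x)\<close>.\<close>

definition diagonal_fm :: "'c fm" where
  "diagonal_fm = ExN (Ap (FV 0) (Pl (Ap (FV 1) (Pl (NV 0) (NV 1))) (NV 0)) \<^bold>= Sc Ze)"

text \<open>The decidability premise is a classical tautology, so validity would put a
  characteristic function of the diagonal set into \<open>recf\<close>, against
  \<open>diagonal_not_recf\<close>.\<close>

lemma not_valid_CF_d: "\<not> valid I recf (CF_d_instance diagonal_fm)"
proof
  define r where "r = case_nat orc (\<lambda>_. triangle)"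
  have "range r \<subseteq> recf"
    by (auto simp: r_def image_subset_iff orc_recf triangle_recf split: nat.split)
  moreover assume "valid I recf (CF_d_instance diagonal_fm)"
  ultimately have "sat I recf (\<lambda>_. 0) r (CF_d_instance diagonal_fm)"
    by (simp add: valid_def)
  then obtain f where "f \<in> recf" and "\<forall>x. f x \<le> 1"
    and "\<forall>x. f x = 0 \<longleftrightarrow> (\<exists>s. orc (prod_encode (s, x)) = 1)"
    by (auto simp: CF_d_instance_def Iff_def diagonal_fm_def sat_Leq sat_ren cZero_eq cSuc_eq cPlus_eq
        r_def prod_encode_def)
  with diagonal_not_recf[of f] show False by auto
qed

lemma CF_d_unprovable:
  assumes "\<And>A. A \<in> T \<Longrightarrow> valid I recf A"
  shows "\<exists>C\<in>CF_d. \<not> T \<union> QF_AC00 \<turnstile> C"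
proof
  have "wf_fm diagonal_fm"
    by (simp add: diagonal_fm_def arity_cZero arity_cSuc arity_cPlus)
  then show "CF_d_instance diagonal_fm \<in> CF_d"
    by (auto simp: CF_d_def)
  show "\<not> T \<union> QF_AC00 \<turnstile> CF_d_instance diagonal_fm"
    using soundness[of "T \<union> QF_AC00" _ I recf] not_valid_CF_d assms valid_QF_AC00 ev_fctr_recf
    by blast
qed

end

section \<open>Unprovability in \<open>IA\<^sub>1\<close>\<close>

definition sgbar :: "nat \<Rightarrow> nat" where "sgbar x = of_bool (x = 0)"

definition sg :: "nat \<Rightarrow> nat" where "sg x = of_bool (x \<noteq> 0)"

text \<open>For \<open>f\<close> with values in {0, 1} the product is 1 exactly while no zero has
  occurred, so the sum counts the arguments before the first zero.\<close>

definition kleene_mu :: "nat \<Rightarrow> (nat \<Rightarrow> nat) \<Rightarrow> nat" where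
  "kleene_mu z f = (\<Sum>x<z. \<Prod>s<Suc x. f s)"

text \<open>The constants are interpreted by transcribing their defining equations, so that nothing needs
  to be known about primes or exponents.\<close>

definition next_prime :: "nat \<Rightarrow> nat" where
  "next_prime p = kleene_mu (Suc (Suc (fact p)))
     (\<lambda>v. sg (sgbar (v - p) + (sgbar (v - 1) + (\<Sum>c<v. sg (c - 1) * sgbar (v mod c)))))"

definition ia_prime :: "nat \<Rightarrow> nat" where
  "ia_prime n = rec_nat 2 (\<lambda>_. next_prime) n"

definition ia_expo :: "nat \<Rightarrow> nat \<Rightarrow> nat" where
  "ia_expo a b = kleene_mu a (\<lambda>x. sg (a mod ia_prime b ^ x + sgbar (a mod ia_prime b ^ Suc x)))"

definition ia_lh :: "nat \<Rightarrow> nat" where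
  "ia_lh a = (\<Sum>i<a. sg (ia_expo a i))"

definition ia_circ :: "nat \<Rightarrow> nat \<Rightarrow> nat" where
  "ia_circ a b = (\<Prod>i<max a b. ia_prime i ^ max (ia_expo a i) (ia_expo b i))"

primrec ia_interp :: "ia_const interp" where
  "ia_interp IZero xs fs = 0"
| "ia_interp ISuc xs fs = Suc (xs ! 0)"
| "ia_interp IPlus xs fs = xs ! 0 + xs ! 1"
| "ia_interp ITimes xs fs = xs ! 0 * xs ! 1"
| "ia_interp IPow xs fs = xs ! 0 ^ xs ! 1"
| "ia_interp IFact xs fs = fact (xs ! 0)"
| "ia_interp IMonus xs fs = xs ! 0 - xs ! 1"
| "ia_interp IPred xs fs = xs ! 0 - 1"
| "ia_interp IMin xs fs = min (xs ! 0) (xs ! 1)"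
| "ia_interp IMax xs fs = max (xs ! 0) (xs ! 1)"
| "ia_interp ISgbar xs fs = sgbar (xs ! 0)"
| "ia_interp ISg xs fs = sg (xs ! 0)"
| "ia_interp IAbsdiff xs fs = (xs ! 0 - xs ! 1) + (xs ! 1 - xs ! 0)"
| "ia_interp IRem xs fs = xs ! 0 mod xs ! 1"
| "ia_interp IQuot xs fs = xs ! 0 div xs ! 1"
| "ia_interp ISum xs fs = (\<Sum>i<xs ! 0. (fs ! 0) i)"
| "ia_interp IProd xs fs = (\<Prod>i<xs ! 0. (fs ! 0) i)"
| "ia_interp IBMin xs fs = rec_nat ((fs ! 0) 0) (\<lambda>i m. min m ((fs ! 0) (Suc i))) (xs ! 0)"
| "ia_interp IBMax xs fs = rec_nat ((fs ! 0) 0) (\<lambda>i m. max m ((fs ! 0) (Suc i))) (xs ! 0)"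
| "ia_interp IPrime xs fs = ia_prime (xs ! 0)"
| "ia_interp IExpo xs fs = ia_expo (xs ! 0) (xs ! 1)"
| "ia_interp ILh xs fs = ia_lh (xs ! 0)"
| "ia_interp IConc xs fs =
     xs ! 0 * (\<Prod>i<ia_lh (xs ! 1). ia_prime (ia_lh (xs ! 0) + i) ^ ia_expo (xs ! 1) i)"
| "ia_interp IBar xs fs = (\<Prod>i<xs ! 0. ia_prime i ^ Suc ((fs ! 0) i))"
| "ia_interp ITilde xs fs = (\<Prod>i<xs ! 0. ia_prime i ^ (fs ! 0) i)"
| "ia_interp ICirc xs fs = ia_circ (xs ! 0) (xs ! 1)"
| "ia_interp ICcp xs fs = rec_nat 1 (\<lambda>i r. ia_circ r ((fs ! 0) i)) (xs ! 0)"

section \<open>Computability of the constants of \<open>IA\<^sub>1\<close>\<close>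

lemma computable_sgbar [computable_intros]: "computable a \<Longrightarrow> computable (\<lambda>e. sgbar (a e))"
  unfolding sgbar_def by (intro computable_intros)

lemma computable_sg [computable_intros]: "computable a \<Longrightarrow> computable (\<lambda>e. sg (a e))"
  unfolding sg_def by (intro computable_intros)

lemma sgbar_sum_diff: "sgbar ((x - y) + (y - x)) = of_bool (x = y)"
  by (auto simp: sgbar_def)

lemma sg_sum_diff: "sg ((x - y) + (y - x)) = of_bool (x \<noteq> y)"
  by (auto simp: sg_def)

text \<open>The form of the axiom \<open>rem_suc\<close>, which doubles as a recursion for computing
  remainders. It also holds at \<open>b = 0\<close>, where \<open>a mod 0 = a\<close> and the factor
  \<open>sg\<close> is 1.\<close>

lemma Suc_mod_eq: "Suc a mod b = Suc (a mod b) * sg ((b - Suc (a mod b)) + (Suc (a mod b) - b))"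
  unfolding sg_sum_diff by (auto simp: mod_Suc)

lemma Suc_div_eq: "Suc a div b = a div b + sgbar ((b - Suc (a mod b)) + (Suc (a mod b) - b))"
  unfolding sgbar_sum_diff by (auto simp: div_Suc mod_Suc)

lemma computable_mod [computable_intros]:
  assumes "computable a" and "computable b" shows "computable (\<lambda>e. a e mod b e)"
proof -
  have eq: "rec_nat 0 (\<lambda>_ r. Suc r * sg ((y - Suc r) + (Suc r - y))) x = x mod y" for x y
    by (induction x) (simp_all only: nat.rec Suc_mod_eq mod_0)
  have "computable (\<lambda>e. rec_nat 0 (\<lambda>_ r. Suc r * sg ((e 1 - Suc r) + (Suc r - e 1))) (e 0))"
    by (rule computable_rec) (intro computable_intros)+
  then have "computable (\<lambda>e. e 0 mod e 1)" unfolding eq .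
  from computable_fun2[OF this assms] show ?thesis .
qed

lemma computable_div [computable_intros]:
  assumes "computable a" and "computable b" shows "computable (\<lambda>e. a e div b e)"
proof -
  have eq: "rec_nat 0 (\<lambda>k r. r + sgbar ((y - Suc (k mod y)) + (Suc (k mod y) - y))) x = x div y" for x y
    by (induction x) (simp_all only: nat.rec Suc_div_eq div_0)
  have "computable (\<lambda>e. rec_nat 0
      (\<lambda>k r. r + sgbar ((e 1 - Suc (k mod e 1)) + (Suc (k mod e 1) - e 1))) (e 0))"
    by (rule computable_rec) (intro computable_intros)+
  then have "computable (\<lambda>e. e 0 div e 1)" unfolding eq .
  from computable_fun2[OF this assms] show ?thesis .
qed

lemma computable_kleene_mu:
  assumes "computable a" and "computable (\<lambda>e. f (\<lambda>i. e (Suc i)) (e 0))"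
  shows "computable (\<lambda>e. kleene_mu (a e) (f e))"
  unfolding kleene_mu_def
  \<comment> \<open>Inside the product, \<open>f\<close> has to skip the variable bound by the sum;
    this supplies the shifted body.\<close>
  using computable_apply_rename[of f] assms
  by (intro computable_sum computable_prod computable_intros) (simp_all add: uniform_def computable_var)

lemma computable_ia_prime [computable_intros]:
  assumes "computable a" shows "computable (\<lambda>e. ia_prime (a e))"
proof -
  \<comment> \<open>Variable 1 is the previous value in the recursion for \<open>ia_prime\<close>;
    the counter is ignored.\<close>
  have "computable (\<lambda>e. next_prime (e 1))"
    unfolding next_prime_def
    by (intro computable_kleene_mu computable_sum computable_intros)
  then show ?thesis
    unfolding ia_prime_def by (intro computable_rec computable_intros assms)
qed

lemma computable_ia_expo [computable_intros]:
  assumes "computable a" and "computable b" shows "computable (\<lambda>e. ia_expo (a e) (b e))"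
proof -
  have "computable (\<lambda>e. ia_expo (e 0) (e 1))"
    unfolding ia_expo_def by (intro computable_kleene_mu computable_intros)
  from computable_fun2[OF this assms] show ?thesis .
qed

lemma computable_ia_lh [computable_intros]:
  assumes "computable a" shows "computable (\<lambda>e. ia_lh (a e))"
proof -
  have "ia_lh \<in> recf"
    unfolding recf_def ia_lh_def by (simp, intro computable_sum computable_intros)
  then show ?thesis using assms by (rule computable_fun)
qed

lemma computable_ia_circ [computable_intros]:
  assumes "computable a" and "computable b" shows "computable (\<lambda>e. ia_circ (a e) (b e))"
proof -
  have "computable (\<lambda>e. ia_circ (e 0) (e 1))"
    unfolding ia_circ_def by (intro computable_prod computable_intros)
  from computable_fun2[OF this assms] show ?thesis .
qed

lemma computable_ia_interp:
  assumes "arity c = Some (length ts, length us)"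
    and "\<forall>t\<in>set ts. computable t" and "\<forall>u\<in>set us. uniform u"
  shows "computable (\<lambda>e. ia_interp c (map (\<lambda>t. t e) ts) (map (\<lambda>u. u e) us))"
proof -
  \<comment> \<open>The product in \<open>IConc\<close> binds a variable, so it is treated for plain
    variables here and instantiated by \<open>computable_fun2\<close> below.\<close>
  have conc: "computable (\<lambda>e. \<Prod>i<ia_lh (e 1). ia_prime (ia_lh (e 0) + i) ^ ia_expo (e 1) i)"
    by (intro computable_prod computable_intros)
  consider "c = IZero" | a where "ts = [a]" "us = []" "computable a" "arity c = Some (1, 0)"
    | a u where "ts = [a]" "us = [u]" "computable a" "uniform u" "arity c = Some (1, 1)"
    | a b where "ts = [a, b]" "us = []" "computable a" "computable b" "arity c = Some (2, 0)"
    using assms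
    by (auto simp: arity_ia_const_def Suc_length_conv length_Suc_conv numeral_2_eq_2 split: if_splits)
  then show ?thesis
  proof cases
    case 1
    then show ?thesis by (simp add: computable_const)
  next
    case 2
    then show ?thesis
      by (cases c) (simp_all add: arity_ia_const_def computable_intros del: One_nat_def)
  next
    case (3 a u)
    note intros = computable_sum computable_prod computable_rec computable_intros
      computable_apply_rename[OF 3(4)] 3(3)
    have "computable (\<lambda>e. ia_interp c [a e] [u e])"
    proof (cases c)
      case ISum
      show ?thesis unfolding ISum by (simp, intro intros)
    next
      case IProd
      show ?thesis unfolding IProd by (simp, intro intros)
    next
      case IBMin
      show ?thesis unfolding IBMin by (simp, intro intros)
    next
      case IBMax
      show ?thesis unfolding IBMax by (simp, intro intros)
    next
      case IBar
      show ?thesis unfolding IBar by (simp, intro intros)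
    next
      case ITilde
      show ?thesis unfolding ITilde by (simp, intro intros)
    next
      case ICcp
      show ?thesis unfolding ICcp by (simp, intro intros)
    qed (use 3(5) in \<open>simp_all add: arity_ia_const_def\<close>)
    then show ?thesis by (simp add: 3)
  next
    case (4 a b)
    then show ?thesis
      using computable_fun2[OF conc 4(3,4)]
      by (cases c) (simp_all add: arity_ia_const_def computable_intros)
  qed
qed

interpretation ia: computable_model ia_interp
proof
  fix c :: ia_const and ts us
  assume "arity c = Some (length ts, length us)" "\<forall>t\<in>set ts. computable t" "\<forall>u\<in>set us. uniform u"
  then show "computable (\<lambda>e. ia_interp c (map (\<lambda>t. t e) ts) (map (\<lambda>u. u e) us))"
    by (rule computable_ia_interp)
qed (simp_all add: arity_ia_const_def cZero_ia_const_def cSuc_ia_const_def cPlus_ia_const_def)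

lemma ev_bounded_mu:
  "ev_trm ia_interp e r (bounded_mu z t) =
     kleene_mu (ev_trm ia_interp e r z) (\<lambda>x. ev_trm ia_interp (push x e) r t)"
  by (simp add: bounded_mu_def kleene_mu_def ev_ren case_nat_lift_ren)

text \<open>Collapses the right-hand side of \<open>prime_suc\<close> to one value, so that the
  axiom becomes the recursion equation of \<open>ia_prime\<close>.\<close>

lemma ev_next_prime:
  "ev_trm ia_interp e r
     (bounded_mu (con1 ISuc (con1 ISuc (con1 IFact (con1 IPrime (NV 0)))))
       (prime_above (con1 IPrime (NV 1)) (NV 0))) = next_prime (ia_prime (e 0))"
  by (simp add: ev_bounded_mu next_prime_def prime_above_def cZero_ia_const_def)

lemma valid_IA1: "A \<in> IA1 \<Longrightarrow> valid ia_interp recf A"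
proof (induction rule: IA1.induct)
  case (ind A)
  show ?case by (rule ia.valid_induction_instance)
next
  case (lambda_conv t s)
  show ?case by (rule ia.valid_lambda_conv)
next
  case prime_suc
  show ?case
    unfolding valid_def sat.simps ev_next_prime by (simp add: ia_prime_def)
next
  case rem_suc
  show ?case
    unfolding valid_def by (simp add: Suc_mod_eq)
next
  case quot_suc
  show ?case
    unfolding valid_def by (simp add: Suc_div_eq)
next
  case expo_eq
  show ?case
    unfolding valid_def by (simp add: ev_bounded_mu ia_expo_def)
next
  case conc_eq
  show ?case
    unfolding valid_def by simp
next
  case lh_eq
  show ?case
    unfolding valid_def by (simp add: ia_lh_def)
next
  case circ_eq
  show ?case
    unfolding valid_def by (simp add: ia_circ_def)
next
  case min_eq
  show ?case by (auto simp: valid_def)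
next
  case max_eq
  show ?case by (auto simp: valid_def)
qed (simp_all add: valid_def cZero_ia_const_def sg_def sgbar_def ia_prime_def)

section \<open>Unprovability in \<open>EL\<close>\<close>

primrec pr_fun :: "prd \<Rightarrow> nat list \<Rightarrow> nat" where
  "pr_fun PSuc xs = Suc (xs ! 0)"
| "pr_fun (PConst n q) xs = q"
| "pr_fun (PProj n i) xs = xs ! i"
| "pr_fun (PComp f gs) xs = pr_fun f (map (\<lambda>g. pr_fun g xs) gs)"
| "pr_fun (PRec0 q h) xs = rec_nat q (\<lambda>k r. pr_fun h [k, r]) (xs ! 0)"
| "pr_fun (PRec g h) xs = rec_nat (pr_fun g (tl xs)) (\<lambda>k r. pr_fun h (k # r # tl xs)) (hd xs)"

lemma pr_fun_plus: "pr_fun prd_plus [x, y] = x + y"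
  unfolding prd_plus_def by (induction x) simp_all

lemma pr_fun_times: "pr_fun prd_times [x, y] = x * y"
  unfolding prd_times_def by (induction x) (simp_all add: pr_fun_plus)

lemma pr_fun_pow: "pr_fun prd_pow [x, y] = y ^ x"
  unfolding prd_pow_def by (induction x) (simp_all add: pr_fun_times)

primrec el_interp :: "el_const interp" where
  "el_interp EZero xs fs = 0"
| "el_interp (EPr f) xs fs = pr_fun f xs"
| "el_interp ERec xs fs = rec_nat (xs ! 0) (\<lambda>k r. (fs ! 0) (2 ^ r * 3 ^ k)) (xs ! 1)"

text \<open>Arbitrary computable arguments \<open>ts\<close> instead of variables make the
  composition case the induction hypothesis for \<open>f\<close> at the values of
  \<open>gs\<close>.\<close>

lemma computable_pr_fun:
  assumes "wf_prd f" and "prd_arity f = length ts" and "\<forall>t\<in>set ts. computable t"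
  shows "computable (\<lambda>e. pr_fun f (map (\<lambda>t. t e) ts))"
  using assms
proof (induction f arbitrary: ts)
  case PSuc
  then show ?case by (auto simp: Suc_length_conv intro: computable_Suc)
next
  case (PConst n q)
  then show ?case by (simp add: computable_const)
next
  case (PProj n i)
  then show ?case by simp
next
  case (PComp f gs)
  have "\<forall>g\<in>set gs. prd_arity g = length ts"
    using PComp.prems by (cases gs) auto
  then have "\<forall>g\<in>set gs. computable (\<lambda>e. pr_fun g (map (\<lambda>t. t e) ts))"
    using PComp.IH(2) PComp.prems by (auto simp: list_all_iff)
  then have "computable (\<lambda>e. pr_fun f (map (\<lambda>t. t e) (map (\<lambda>g e. pr_fun g (map (\<lambda>t. t e) ts)) gs)))"
    using PComp.prems by (intro PComp.IH(1)) auto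
  then show ?case by (simp add: comp_def)
next
  case (PRec0 q h)
  then obtain t where t: "ts = [t]" "computable t" by (auto simp: Suc_length_conv)
  have "computable (\<lambda>e. pr_fun h [e 0, e 1])"
    using PRec0.IH[of "[\<lambda>e. e 0, \<lambda>e. e 1]"] PRec0.prems by (simp add: computable_var)
  with t show ?case by (simp, intro computable_rec computable_intros)
next
  case (PRec g h)
  then obtain s us where ts: "ts = s # us" "computable s" "\<forall>t\<in>set us. computable t" "prd_arity g = length us"
    by (auto simp: Suc_length_conv)
  \<comment> \<open>In the body of the recursion the counter and the previous value occupy variables
    0 and 1, so the parameters are read two places further on.\<close>
  have "\<forall>t\<in>set us. computable (\<lambda>e. t (\<lambda>i. e (Suc (Suc i))))"
    using ts(3) by (auto intro: computable_rename)
  then have "computable (\<lambda>e. pr_fun h (e 0 # e 1 # map (\<lambda>t. t (\<lambda>i. e (Suc (Suc i)))) us))"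
    using PRec.IH(2)[of "(\<lambda>e. e 0) # (\<lambda>e. e 1) # map (\<lambda>t e. t (\<lambda>i. e (Suc (Suc i)))) us"] PRec.prems ts
    by (simp add: computable_var comp_def)
  moreover have "computable (\<lambda>e. pr_fun g (map (\<lambda>t. t e) us))"
    using PRec.IH(1) PRec.prems ts by simp
  ultimately show ?case
    using ts by (simp, intro computable_rec)
qed

lemma computable_el_interp:
  assumes "arity c = Some (length ts, length us)"
    and "\<forall>t\<in>set ts. computable t" and "\<forall>u\<in>set us. uniform u"
  shows "computable (\<lambda>e. el_interp c (map (\<lambda>t. t e) ts) (map (\<lambda>u. u e) us))"
proof (cases c)
  case EZero
  then show ?thesis by (simp add: computable_const)
next
  case (EPr f)
  then show ?thesis
    using assms computable_pr_fun[of f ts] by (simp add: arity_el_const_def split: if_splits)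
next
  case ERec
  then obtain a b u where ts: "ts = [a, b]" "us = [u]" "computable a" "computable b" and u: "uniform u"
    using assms by (auto simp: arity_el_const_def Suc_length_conv length_Suc_conv numeral_2_eq_2)
  have "computable (\<lambda>e. rec_nat (a e) (\<lambda>k r. u e (2 ^ r * 3 ^ k)) (b e))"
    by (intro computable_rec computable_apply_rename[OF u] computable_intros ts)
  then show ?thesis by (simp add: ERec ts)
qed

interpretation el: computable_model el_interp
proof
  fix c :: el_const and ts us
  assume "arity c = Some (length ts, length us)" "\<forall>t\<in>set ts. computable t" "\<forall>u\<in>set us. uniform u"
  then show "computable (\<lambda>e. el_interp c (map (\<lambda>t. t e) ts) (map (\<lambda>u. u e) us))"
    by (rule computable_el_interp)
next
  show "arity (cPlus :: el_const) = Some (2, 0)"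
    by (simp add: arity_el_const_def cPlus_el_const_def prd_plus_def)
qed (simp_all add: arity_el_const_def cZero_el_const_def cSuc_el_const_def cPlus_el_const_def pr_fun_plus)

lemma ev_app_prd: "ev_trm el_interp e r (app_prd f ts) = pr_fun f (map (ev_trm el_interp e r) ts)"
  by (simp add: app_prd_def split: list.split)

lemma ev_el_numeral: "ev_trm el_interp e r (el_numeral n) = n"
  by (induction n) (simp_all add: el.cZero_eq el.cSuc_eq)

lemma ev_el_pair:
  "ev_trm el_interp e r (el_pair s t) = 2 ^ ev_trm el_interp e r s * 3 ^ ev_trm el_interp e r t"
  by (simp add: el_pair_def ev_app_prd ev_el_numeral pr_fun_times pr_fun_pow)

lemma valid_HA1: "A \<in> HA1 \<Longrightarrow> valid el_interp recf A"
proof (induction rule: HA1.induct)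
  case (ind A)
  show ?case by (rule el.valid_induction_instance)
next
  case (lambda_conv t s)
  show ?case by (rule el.valid_lambda_conv)
next
  case (eq_replacement A i j)
  show ?case by (auto simp: valid_def sat_instN)
qed (simp_all add: valid_def ev_app_prd ev_el_numeral ev_el_pair el.cZero_eq el.cSuc_eq comp_def)

theorem theorem3p4:
  shows "(\<exists>C \<in> (CF_d :: ia_const fm set). \<not> IA1 \<union> QF_AC00 \<turnstile> C) \<and>
         (\<exists>C \<in> (CF_d :: el_const fm set). \<not> EL \<turnstile> C)"
  unfolding EL_def
  using ia.CF_d_unprovable[OF valid_IA1] el.CF_d_unprovable[OF valid_HA1] by simp

end
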